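(* Suppose Assumptions 1 and 2 (stated in the context) hold. If $K\in\mathcal{K}_\beta$ is a stationary point of $J_{\mathrm{mix}}$, i.e. $\nabla J_{\mathrm{mix}}(K)=0$, then $K$ is a global minimizer of $J_{\mathrm{mix}}$ over $\mathcal{K}_\beta$, i.e. $J_{\mathrm{mix}}(K)=\inf_{K'\in\mathcal{K}_\beta}J_{\mathrm{mix}}(K')$.
   Context: Let $A\in\mathbb{R}^{n\times n}$, $B\in\mathbb{R}^{n\times m}$, $B_w\in\mathbb{R}^{n\times n}$, $W:=B_wB_w^{\mathsf T}$. Let $Q_2\succeq0$, $R_2\succ0$, $Q_\infty\succ0$, $R_\infty\succ0$ be symmetric weight matrices of appropriate sizes and let $\beta>0$. For $K\in\mathbb{R}^{m\times n}$ write $A_K:=A+BK$ and $S_K:=Q_\infty+K^{\mathsf T}R_\infty K$. Let $\mathcal{K}:=\{K\in\mathbb{R}^{m\times n}: A_K \text{ is Hurwitz}\}$. For $K\in\mathcal{K}$ let $\mathbf{T}_\infty(K)(s)=\begin{bmatrix}Q_\infty^{1/2}\\ R_\infty^{1/2}K\end{bmatrix}(sI-A_K)^{-1}B_w$, and let $\|\cdot\|_{\mathcal{H}_\infty}$ denote the $\mathcal{H}_\infty$ norm. Define $\mathcal{K}_\beta:=\{K\in\mathcal{K}:\|\mathbf{T}_\infty(K)\|_{\mathcal{H}_\infty}<\beta\}$ (an open set). For $K\in\mathcal{K}_\beta$, the Riccati equation $A_KX+XA_K^{\mathsf T}+\beta^{-2}XS_KX+W=0$ has a unique stabilizing solution $X_K$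 (i.e. $A_K+\beta^{-2}X_KS_K$ is Hurwitz), and $X_K\succeq0$. The mixed $\mathcal{H}_2/\mathcal{H}_\infty$ cost is $J_{\mathrm{mix}}(K):=\operatorname{tr}((Q_2+K^{\mathsf T}R_2K)X_K)$ for $K\in\mathcal{K}_\beta$; it is differentiable on $\mathcal{K}_\beta$. Assumption 1: $(A,B)$ is stabilizable, $(Q_2^{1/2},A)$ is detectable, and $\beta>\beta^\ast:=\inf_{K\in\mathcal{K}}\|\mathbf{T}_\infty(K)\|_{\mathcal{H}_\infty}$. Assumption 2: $Q_2\succeq0$, and $W$, $Q_\infty$, $R_2$, $R_\infty$ are positive definite. *)

theory Defs
  imports "HOL-Analysis.Analysis"
begin

text \<open>Matrices are HOL-Analysis matrices: an r x c real matrix has type real^'c^'r.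
  The state dimension n is the (finite) index type 'n, the input dimension m is 'm.\<close>

definition psd :: "real^'n^'n \<Rightarrow> bool" where
  "psd M \<longleftrightarrow> transpose M = M \<and> (\<forall>x. 0 \<le> x \<bullet> (M *v x))"

definition pd :: "real^'n^'n \<Rightarrow> bool" where
  "pd M \<longleftrightarrow> transpose M = M \<and> (\<forall>x. x \<noteq> 0 \<longrightarrow> 0 < x \<bullet> (M *v x))"

definition psd_sqrt :: "real^'n^'n \<Rightarrow> real^'n^'n" where
  "psd_sqrt M = (THE S. psd S \<and> S ** S = M)"

definition cmat :: "real^'c^'r \<Rightarrow> complex^'c^'r" where
  "cmat M = (\<chi> i j. complex_of_real (M $ i $ j))"

definition hurwitz :: "real^'n^'n \<Rightarrow> bool" where
  "hurwitz M \<longleftrightarrow> (\<forall>z::complex. det (mat z - cmat M) = 0 \<longrightarrow> Re z < 0)"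

definition stabilizable :: "real^'n^'n \<Rightarrow> real^'m^'n \<Rightarrow> bool" where
  "stabilizable A B \<longleftrightarrow> (\<exists>K::real^'n^'m. hurwitz (A + B ** K))"

text \<open>(C, A) detectable iff (A^T, C^T) stabilizable, i.e. there is an output injection L.\<close>
definition detectable :: "real^'n^'p \<Rightarrow> real^'n^'n \<Rightarrow> bool" where
  "detectable C A \<longleftrightarrow> (\<exists>L::real^'p^'n. hurwitz (A + L ** C))"

definition closed_loop :: "real^'n^'n \<Rightarrow> real^'m^'n \<Rightarrow> real^'n^'m \<Rightarrow> real^'n^'n" where
  "closed_loop A B K = A + B ** K"

definition S_mat :: "real^'n^'n \<Rightarrow> real^'m^'m \<Rightarrow> real^'n^'m \<Rightarrow> real^'n^'n" where
  "S_mat Qi Ri K = Qi + transpose K ** Ri ** K"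

definition Cinf :: "real^'n^'n \<Rightarrow> real^'m^'m \<Rightarrow> real^'n^'m \<Rightarrow> real^'n^('n + 'm)" where
  "Cinf Qi Ri K = (\<chi> i. case i of Inl a \<Rightarrow> psd_sqrt Qi $ a | Inr b \<Rightarrow> (psd_sqrt Ri ** K) $ b)"

definition Tinf :: "real^'n^'n \<Rightarrow> real^'m^'n \<Rightarrow> real^'n^'n \<Rightarrow> real^'n^'n \<Rightarrow> real^'m^'m
    \<Rightarrow> real^'n^'m \<Rightarrow> complex \<Rightarrow> complex^'n^('n + 'm)" where
  "Tinf A B Bw Qi Ri K s =
     cmat (Cinf Qi Ri K) ** matrix_inv (mat s - cmat (closed_loop A B K)) ** cmat Bw"

definition spec_norm :: "complex^'c^'r \<Rightarrow> real" where
  "spec_norm M = onorm (\<lambda>x. M *v x)"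

definition hinf_norm :: "real^'n^'n \<Rightarrow> real^'m^'n \<Rightarrow> real^'n^'n \<Rightarrow> real^'n^'n \<Rightarrow> real^'m^'m
    \<Rightarrow> real^'n^'m \<Rightarrow> real" where
  "hinf_norm A B Bw Qi Ri K = (SUP \<omega>::real. spec_norm (Tinf A B Bw Qi Ri K (\<i> * complex_of_real \<omega>)))"

definition stabilizing_set :: "real^'n^'n \<Rightarrow> real^'m^'n \<Rightarrow> (real^'n^'m) set" where
  "stabilizing_set A B = {K. hurwitz (closed_loop A B K)}"

definition Kbeta :: "real^'n^'n \<Rightarrow> real^'m^'n \<Rightarrow> real^'n^'n \<Rightarrow> real^'n^'n \<Rightarrow> real^'m^'m
    \<Rightarrow> real \<Rightarrow> (real^'n^'m) set" where
  "Kbeta A B Bw Qi Ri \<beta> = {K \<in> stabilizing_set A B. hinf_norm A B Bw Qi Ri K < \<beta>}"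

definition riccati_X :: "real^'n^'n \<Rightarrow> real^'m^'n \<Rightarrow> real^'n^'n \<Rightarrow> real^'n^'n \<Rightarrow> real^'m^'m
    \<Rightarrow> real \<Rightarrow> real^'n^'m \<Rightarrow> real^'n^'n" where
  "riccati_X A B Bw Qi Ri \<beta> K =
    (THE X. transpose X = X \<and>
       closed_loop A B K ** X + X ** transpose (closed_loop A B K)
         + (1 / \<beta>\<^sup>2) *\<^sub>R (X ** S_mat Qi Ri K ** X) + Bw ** transpose Bw = 0 \<and>
       hurwitz (closed_loop A B K + (1 / \<beta>\<^sup>2) *\<^sub>R (X ** S_mat Qi Ri K)))"

definition J_mix :: "real^'n^'n \<Rightarrow> real^'m^'n \<Rightarrow> real^'n^'n \<Rightarrow> real^'n^'n \<Rightarrow> real^'m^'m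
    \<Rightarrow> real^'n^'n \<Rightarrow> real^'m^'m \<Rightarrow> real \<Rightarrow> real^'n^'m \<Rightarrow> real" where
  "J_mix A B Bw Q2 R2 Qi Ri \<beta> K =
     trace ((Q2 + transpose K ** R2 ** K) ** riccati_X A B Bw Qi Ri \<beta> K)"

end

theory Submission
  imports Defs
begin

text \<open>Substituting \<open>Y = K X\<close> makes the Riccati operator matrix convex and the cost jointly convex in
  \<open>(X, Y)\<close>. The segment from \<open>(X, K X)\<close> to \<open>(X', K' X')\<close>, with \<open>X\<close>, \<open>X'\<close> the stabilizing solutions,
  consists of Riccati supersolutions for the gains \<open>Kt = Yt Xt\<^sup>-\<^sup>1\<close>. As the stabilizing solution lies
  below every supersolution, \<open>J(Kt) \<le> (1 - t) J(K) + t J(K')\<close>, while stationarity gives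
  \<open>J(Kt) = J(K) + o(t)\<close>; hence \<open>J(K) \<le> J(K')\<close>. The stabilizing solution exists on \<open>K\<^sub>\<beta>\<close> by a homotopy in the
  coefficient \<open>\<tau> \<le> \<beta>\<^sup>-\<^sup>2\<close> of the quadratic term: strict supersolutions persist under small
  changes of \<open>\<tau>\<close>, and the norm bound keeps eigenvalues off the imaginary axis in the limit.
  Hurwitz stability is used throughout in its Lyapunov form.\<close>

text \<open>The delicate point is the gain \<open>Kt\<close>: it is never shown to lie in
  \<open>Kbeta\<close>. What the cost at \<open>Kt\<close> needs is a stabilizing Riccati solution,
  and Newton's method produces one from any strict supersolution. Strictness is an open condition,
  so one strict supersolution at \<open>K\<close> serves all gains near \<open>K\<close>. The points
  of the segment are in general only weak supersolutions; they serve for comparison, not for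
  existence. The step to o(t) also needs a rate: \<open>norm (Kt t - K)\<close> must be O(t). This
  holds because \<open>X\<close> is bounded below by a positive multiple of the identity, which
  comes from the definiteness of \<open>W\<close>. In Lyapunov form, stability has two complementary
  properties: a certificate survives small perturbations, and in a limit of stable matrices only an
  eigenvalue on the imaginary axis can destroy it. This pair yields both the equivalence with the
  Hurwitz property, by shifting the spectrum, and the homotopy in \<open>\<tau>\<close>.\<close>

declare transpose_matrix_vector [simp del] vector_transpose_matrix [simp del]

section \<open>Bilinear matrix algebra and norm estimates\<close>

lemma bounded_bilinear_matrix_mult:
  "bounded_bilinear ((**) :: real^'b^'a \<Rightarrow> real^'c^'b \<Rightarrow> real^'c^'a)"
  unfolding bilinear_conv_bounded_bilinear[symmetric] bilinear_def
  by (auto intro!: linearI simp: vec_eq_iff matrix_matrix_mult_def sum.distrib algebra_simps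
      sum_distrib_left)

lemma bounded_bilinear_matrix_vector_mult:
  "bounded_bilinear ((*v) :: real^'b^'a \<Rightarrow> real^'b \<Rightarrow> real^'a)"
  unfolding bilinear_conv_bounded_bilinear[symmetric] bilinear_def
  by (auto intro!: linearI simp: vec_eq_iff matrix_vector_mult_def sum.distrib algebra_simps
      sum_distrib_left)

lemma bounded_linear_transpose: "bounded_linear (transpose :: real^'b^'a \<Rightarrow> real^'a^'b)"
  unfolding linear_conv_bounded_linear[symmetric]
  by (auto intro!: linearI simp: vec_eq_iff transpose_def)

lemmas linear_transpose = bounded_linear.linear[OF bounded_linear_transpose]

lemmas mat_simps =
  bounded_bilinear.add_left[OF bounded_bilinear_matrix_mult]
  bounded_bilinear.add_right[OF bounded_bilinear_matrix_mult]
  bounded_bilinear.diff_left[OF bounded_bilinear_matrix_mult]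
  bounded_bilinear.diff_right[OF bounded_bilinear_matrix_mult]
  bounded_bilinear.minus_left[OF bounded_bilinear_matrix_mult]
  bounded_bilinear.minus_right[OF bounded_bilinear_matrix_mult]
  bounded_bilinear.scaleR_left[OF bounded_bilinear_matrix_mult]
  bounded_bilinear.scaleR_right[OF bounded_bilinear_matrix_mult]
  bounded_bilinear.zero_left[OF bounded_bilinear_matrix_mult]
  bounded_bilinear.zero_right[OF bounded_bilinear_matrix_mult]
  linear_add[OF linear_transpose]
  linear_diff[OF linear_transpose]
  linear_neg[OF linear_transpose]
  linear_scale[OF linear_transpose]
  linear_0[OF linear_transpose]
  matrix_transpose_mul matrix_mul_assoc scaleR_add_right scaleR_diff_right scaleR_add_left
  scaleR_diff_left

lemmas vec_simps =
  bounded_bilinear.add_left[OF bounded_bilinear_matrix_vector_mult]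
  bounded_bilinear.add_right[OF bounded_bilinear_matrix_vector_mult]
  bounded_bilinear.diff_left[OF bounded_bilinear_matrix_vector_mult]
  bounded_bilinear.diff_right[OF bounded_bilinear_matrix_vector_mult]
  bounded_bilinear.minus_left[OF bounded_bilinear_matrix_vector_mult]
  bounded_bilinear.minus_right[OF bounded_bilinear_matrix_vector_mult]
  bounded_bilinear.scaleR_left[OF bounded_bilinear_matrix_vector_mult]
  bounded_bilinear.scaleR_right[OF bounded_bilinear_matrix_vector_mult]
  inner_add_left inner_add_right inner_diff_left inner_diff_right
  matrix_vector_mul_assoc[symmetric]

lemmas tendsto_matrix_mult = bounded_bilinear.tendsto[OF bounded_bilinear_matrix_mult]
lemmas tendsto_matrix_vector_mult =
  bounded_bilinear.tendsto[OF bounded_bilinear_matrix_vector_mult]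
lemmas tendsto_transpose = bounded_linear.tendsto[OF bounded_linear_transpose]

lemma inner_transpose: "x \<bullet> (transpose M *v y) = (M *v x) \<bullet> (y :: real^'a)"
  by (metis dot_lmul_matrix inner_commute transpose_matrix_vector)

lemma inner_symmetric: "transpose M = M \<Longrightarrow> x \<bullet> (M *v y) = (M *v x) \<bullet> (y :: real^'a)"
  by (metis inner_transpose)

lemma norm_matrix_vector_mult_le:
  fixes M :: "'a::{real_normed_field}^'n^'m"
  shows "norm (M *v x) \<le> norm M * norm x"
proof -
  have "norm ((M *v x) $ i) \<le> norm (M $ i) * norm x" for i
  proof -
    have "norm ((M *v x) $ i) \<le> (\<Sum>j\<in>UNIV. norm (M $ i $ j) * norm (x $ j))"
      unfolding matrix_vector_mult_def by (simp add: norm_mult[symmetric] norm_sum)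
    also have "\<dots> \<le> L2_set (\<lambda>j. norm (M $ i $ j)) UNIV * L2_set (\<lambda>j. norm (x $ j)) UNIV"
      using L2_set_mult_ineq[of "\<lambda>j. norm (M $ i $ j)" "\<lambda>j. norm (x $ j)" UNIV] by simp
    finally show ?thesis by (simp add: norm_vec_def)
  qed
  then have "norm (M *v x) \<le> L2_set (\<lambda>i. norm (M $ i) * norm x) UNIV"
    unfolding norm_vec_def[of "M *v x"] by (intro L2_set_mono) auto
  also have "\<dots> = norm M * norm x"
    by (simp add: norm_vec_def[of M] L2_set_left_distrib)
  finally show ?thesis .
qed

lemma quadratic_form_le: "x \<bullet> (M *v x) \<le> norm M * (norm x)\<^sup>2" for x :: "real^'n"
proof -
  have "x \<bullet> (M *v x) \<le> norm x * norm (M *v x)" by (rule norm_cauchy_schwarz)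
  also have "\<dots> \<le> norm x * (norm M * norm x)"
    by (intro mult_left_mono norm_matrix_vector_mult_le) auto
  finally show ?thesis by (simp add: power2_eq_square mult_ac)
qed

section \<open>Positive semidefinite matrices\<close>

lemma psd_symD: "psd M \<Longrightarrow> transpose M = M" and psdD: "psd M \<Longrightarrow> 0 \<le> x \<bullet> (M *v x)"
  by (auto simp: psd_def)

lemma pd_symD: "pd M \<Longrightarrow> transpose M = M" and pdD: "pd M \<Longrightarrow> x \<noteq> 0 \<Longrightarrow> 0 < x \<bullet> (M *v x)"
  by (auto simp: pd_def)

lemma pd_imp_psd: "pd M \<Longrightarrow> psd M"
  unfolding psd_def pd_def by (metis inner_zero_left order.refl order_less_imp_le)

lemma psd_0: "psd 0" and pd_mat_1: "pd (mat 1)"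
  by (auto simp: psd_def pd_def mat_simps)

lemma psd_add: "psd M \<Longrightarrow> psd N \<Longrightarrow> psd (M + N)"
  by (auto simp: psd_def mat_simps vec_simps)

lemma pd_add_psd: "pd M \<Longrightarrow> psd N \<Longrightarrow> pd (M + N)" and psd_add_pd: "psd M \<Longrightarrow> pd N \<Longrightarrow> pd (M + N)"
  by (auto simp: psd_def pd_def mat_simps vec_simps add_pos_nonneg add_nonneg_pos)

lemma psd_scaleR: "psd M \<Longrightarrow> 0 \<le> c \<Longrightarrow> psd (c *\<^sub>R M)" and pd_scaleR: "pd M \<Longrightarrow> 0 < c \<Longrightarrow> pd (c *\<^sub>R M)"
  by (auto simp: psd_def pd_def mat_simps vec_simps)

lemma psd_congruence: "psd M \<Longrightarrow> psd (transpose T ** M ** T)"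
  by (auto simp: psd_def mat_simps vec_simps inner_transpose)

text \<open>Moving from \<open>v\<close> in the direction \<open>- (N *v v)\<close> lowers the form
  to first order at a rate proportional to the squared length of \<open>N *v v\<close>, so a nonzero
  \<open>N *v v\<close> would make it negative.\<close>

lemma psd_kernel:
  assumes "psd N" "v \<bullet> (N *v v) = 0"
  shows "N *v v = 0"
proof -
  have sym: "transpose N = N" using assms(1) by (rule psd_symD)
  let ?w = "N *v v"
  have *: "0 \<le> 2 * t * (?w \<bullet> ?w) + t\<^sup>2 * (?w \<bullet> (N *v ?w))" for t
  proof -
    have "0 \<le> (v + t *\<^sub>R ?w) \<bullet> (N *v (v + t *\<^sub>R ?w))" by (rule psdD[OF assms(1)])
    also have "\<dots> = 2 * t * (?w \<bullet> ?w) + t\<^sup>2 * (?w \<bullet> (N *v ?w))"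
      using assms(2) inner_symmetric[OF sym, of v ?w]
      by (simp add: vec_simps algebra_simps power2_eq_square)
    finally show ?thesis .
  qed
  define a b where "a = ?w \<bullet> ?w" and "b = ?w \<bullet> (N *v ?w)"
  have b0: "b \<ge> 0" unfolding b_def by (rule psdD[OF assms(1)])
  have *: "0 \<le> - 2 * s * a + s\<^sup>2 * b" for s
    using *[of "-s"] unfolding a_def b_def by simp
  have a0: "a \<ge> 0" unfolding a_def by simp
  have "a = 0"
  proof (rule ccontr)
    assume "a \<noteq> 0" then have "a > 0" using a0 by simp
    \<comment> \<open>Since \<open>s * (1 + b) = a\<close>, the quadratic term
      \<open>s * s * b\<close> is at most \<open>s * a\<close>, half of the linear decrease. The 1
      covers the case \<open>b = 0\<close>.\<close>
    define s where "s = a / (1 + b)"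
    have s: "s > 0" "s * (1+b) = a" using \<open>a > 0\<close> b0 by (auto simp: s_def)
    have "s * b \<le> a" using s by (simp add: algebra_simps)
    then have "s * (s * b) \<le> s * a" using s(1) by simp
    with *[of s] s(1) \<open>a > 0\<close> show False
      by (simp add: power2_eq_square algebra_simps)
  qed
  then show ?thesis by (simp add: a_def)
qed

lemma psd_imp_pd: "psd P \<Longrightarrow> (\<And>v. P *v v = 0 \<Longrightarrow> v = 0) \<Longrightarrow> pd P"
  unfolding pd_def using psd_kernel psd_def by (metis order_le_imp_less_or_eq)

lemma psd_antisym:
  assumes "psd P" "psd (- P)" shows "P = 0"
proof -
  have "P *v v = 0" for v
  proof (rule psd_kernel[OF assms(1)])
    show "v \<bullet> (P *v v) = 0"
      using psdD[OF assms(1), of v] psdD[OF assms(2), of v] by (simp add: vec_simps)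
  qed
  then show ?thesis by (simp add: matrix_eq)
qed

text \<open>Compactness of the unit sphere of \<open>V\<close>. Positivity of \<open>P0\<close> is
  asked on \<open>V\<close> only, so that a singular form can be used on its range. The form of
  \<open>P - \<mu> P0\<close> is nonnegative on \<open>V\<close> and touches zero at
  \<open>v\<close>, which is the situation of \<open>psd_kernel\<close>.\<close>

lemma rayleigh_min:
  fixes P P0 :: "real^'n^'n" and V :: "(real^'n) set"
  assumes "subspace V" "V \<noteq> {0}" and pos: "\<And>x. x \<in> V \<Longrightarrow> x \<noteq> 0 \<Longrightarrow> 0 < x \<bullet> (P0 *v x)"
  obtains v \<mu> where "v \<in> V" "v \<noteq> 0" "v \<bullet> (P *v v) = \<mu> * (v \<bullet> (P0 *v v))"
    "\<And>x. x \<in> V \<Longrightarrow> \<mu> * (x \<bullet> (P0 *v x)) \<le> x \<bullet> (P *v x)"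
proof -
  define S where "S = V \<inter> sphere 0 1"
  have "compact S" unfolding S_def using assms(1)
    by (intro closed_Int_compact closed_subspace) auto
  moreover have "S \<noteq> {}"
  proof -
    obtain x where "x \<in> V" "x \<noteq> 0" using assms(1,2) subspace_0 by blast
    then have "(1 / norm x) *\<^sub>R x \<in> S" using assms(1) by (simp add: S_def subspace_scale)
    then show ?thesis by blast
  qed
  moreover have p: "0 < x \<bullet> (P0 *v x)" if "x \<in> S" for x
    using that by (intro pos) (auto simp: S_def)
  have "continuous_on S (\<lambda>x. (x \<bullet> (P *v x)) / (x \<bullet> (P0 *v x)))"
    using p by (intro continuous_intros) force+
  ultimately obtain v where v: "v \<in> S"
    "\<And>x. x \<in> S \<Longrightarrow> (v \<bullet> (P *v v)) / (v \<bullet> (P0 *v v)) \<le> (x \<bullet> (P *v x)) / (x \<bullet> (P0 *v x))"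
    using continuous_attains_inf by (metis (no_types, lifting))
  define \<mu> where "\<mu> = (v \<bullet> (P *v v)) / (v \<bullet> (P0 *v v))"
  show thesis
  proof
    show "v \<in> V" "v \<noteq> 0" using v(1) by (auto simp: S_def)
    show "v \<bullet> (P *v v) = \<mu> * (v \<bullet> (P0 *v v))" using p[OF v(1)] by (simp add: \<mu>_def)
    fix x assume x: "x \<in> V"
    show "\<mu> * (x \<bullet> (P0 *v x)) \<le> x \<bullet> (P *v x)"
    proof (cases "x = 0")
      case False
      have "(1 / norm x) *\<^sub>R x \<in> S" using assms(1) x False by (simp add: S_def subspace_scale)
      from v(2)[OF this] have "\<mu> \<le> (x \<bullet> (P *v x)) / (x \<bullet> (P0 *v x))"
        using False by (simp add: \<mu>_def vec_simps)
      then show ?thesis using pos[OF x False] by (simp add: field_simps)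
    qed simp
  qed
qed

lemma pd_bounded_below:
  fixes P :: "real^'n^'n"
  assumes "pd P"
  obtains c where "c > 0" "\<And>x. c * (norm x)\<^sup>2 \<le> x \<bullet> (P *v x)"
proof -
  have ne: "UNIV \<noteq> {0 :: real^'n}"
    by (metis UNIV_I axis_eq_0_iff singletonD zero_neq_one)
  obtain v \<mu> where v: "v \<noteq> 0" "v \<bullet> (P *v v) = \<mu> * (v \<bullet> (mat 1 *v v))"
    "\<And>x. \<mu> * (x \<bullet> (mat 1 *v x)) \<le> x \<bullet> (P *v x)"
    using rayleigh_min[of UNIV "mat 1" P] ne by auto
  have "\<mu> > 0" using pdD[OF assms v(1)] v(1,2) by (auto simp: zero_less_mult_iff) (metis inner_ge_zero not_le)
  then show thesis using v(3) that[of \<mu>] by (simp add: dot_square_norm)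
qed

text \<open>The lower bound \<open>c\<close> of \<open>P\<close> absorbs every perturbation of norm
  below \<open>c\<close>. Symmetry is part of \<open>pd\<close> but not an open condition, hence the
  separate assumption.\<close>

lemma eventually_pd:
  fixes P :: "real^'n^'n"
  assumes "(G \<longlongrightarrow> P) F" "pd P" "eventually (\<lambda>t. transpose (G t) = G t) F"
  shows "eventually (\<lambda>t. pd (G t)) F"
proof -
  obtain c where c: "c > 0" "\<And>x. c * (norm x)\<^sup>2 \<le> x \<bullet> (P *v x)"
    using pd_bounded_below[OF assms(2)] by blast
  have "eventually (\<lambda>t. dist (G t) P < c) F" using assms(1) c(1) by (rule tendstoD)
  with assms(3) show ?thesis
  proof eventually_elim
    case (elim t)
    have "0 < x \<bullet> (G t *v x)" if "x \<noteq> 0" for x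
    proof -
      have "x \<bullet> ((P - G t) *v x) \<le> norm (P - G t) * (norm x)\<^sup>2" by (rule quadratic_form_le)
      also have "\<dots> < c * (norm x)\<^sup>2"
        using elim(2) that by (simp add: dist_norm norm_minus_commute)
      finally show ?thesis using c(2)[of x] by (simp add: vec_simps)
    qed
    with elim(1) show ?case by (simp add: pd_def)
  qed
qed

lemma tendsto_psd:
  assumes "(G \<longlongrightarrow> P) F" "F \<noteq> bot" "eventually (\<lambda>t. psd (G t)) F"
  shows "psd P"
  unfolding psd_def
proof (intro conjI allI)
  have "((\<lambda>t. transpose (G t) - G t) \<longlongrightarrow> transpose P - P) F"
    by (intro tendsto_intros tendsto_transpose assms)
  moreover have "((\<lambda>t. transpose (G t) - G t) \<longlongrightarrow> 0) F"
    by (rule tendsto_eventually) (use assms(3) in \<open>eventually_elim, simp add: psd_symD\<close>)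
  ultimately show "transpose P = P" using assms(2) tendsto_unique by fastforce
  fix x
  have "((\<lambda>t. x \<bullet> (G t *v x)) \<longlongrightarrow> x \<bullet> (P *v x)) F"
    by (intro tendsto_intros tendsto_matrix_vector_mult assms)
  then show "0 \<le> x \<bullet> (P *v x)"
    by (rule tendsto_lowerbound) (use assms in \<open>auto elim!: eventually_mono simp: psdD\<close>)
qed

section \<open>The Lyapunov operator\<close>

definition lyap_op :: "real^'n^'n \<Rightarrow> real^'n^'n \<Rightarrow> real^'n^'n" where
  "lyap_op M P = M ** P + P ** transpose M"

text \<open>A witness \<open>P\<close> for \<open>M\<close> remains a witness for all nearby
  matrices, and checking it involves real quadratic forms only.\<close>

definition lyap_stable :: "real^'n^'n \<Rightarrow> bool" where
  "lyap_stable M \<longleftrightarrow> (\<exists>P. pd P \<and> pd (- lyap_op M P))"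

lemma transpose_lyap_op: "transpose (lyap_op M P) = lyap_op M (transpose P)"
  by (simp add: lyap_op_def mat_simps)

lemma lyap_op_simps:
  "lyap_op M (P + Q) = lyap_op M P + lyap_op M Q"
  "lyap_op M (P - Q) = lyap_op M P - lyap_op M Q"
  "lyap_op M (- P) = - lyap_op M P"
  "lyap_op M (c *\<^sub>R P) = c *\<^sub>R lyap_op M P"
  "lyap_op M 0 = 0"
  by (simp_all add: lyap_op_def mat_simps)

lemma tendsto_lyap_op:
  "(M \<longlongrightarrow> M0) F \<Longrightarrow> (P \<longlongrightarrow> P0) F \<Longrightarrow> ((\<lambda>t. lyap_op (M t) (P t)) \<longlongrightarrow> lyap_op M0 P0) F"
  unfolding lyap_op_def by (intro tendsto_intros tendsto_matrix_mult tendsto_transpose)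

lemma lyap_op_quadratic_form:
  assumes "transpose P = P"
  shows "x \<bullet> (lyap_op M P *v y) = (M *v (P *v y)) \<bullet> x + (M *v (P *v x)) \<bullet> y"
proof -
  have "x \<bullet> (P *v (transpose M *v y)) = (M *v (P *v x)) \<bullet> y"
    by (simp add: inner_symmetric[OF assms] inner_transpose)
  then show ?thesis by (simp add: lyap_op_def vec_simps inner_commute)
qed

lemma lyap_op_kernel:
  "transpose P = P \<Longrightarrow> P *v v = 0 \<Longrightarrow> v \<bullet> (lyap_op M P *v v) = 0"
  by (simp add: lyap_op_quadratic_form)

text \<open>Subtract the largest multiple \<open>\<mu>\<close> of the certificate \<open>P0\<close>
  that leaves a psd matrix \<open>N\<close>. At a kernel vector \<open>v\<close> of \<open>N\<close>
  the form of \<open>lyap_op M N\<close> vanishes, so the forms of \<open>lyap_op M P\<close> and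
  \<open>\<mu> lyap_op M P0\<close> agree there. For \<open>\<mu> < 0\<close> the first is at most
  zero and the second positive.\<close>

lemma lyap_comparison:
  fixes M P :: "real^'n^'n"
  assumes "lyap_stable M" and sym: "transpose P = P" and "psd (- lyap_op M P)"
  shows "psd P"
proof -
  obtain P0 where P0: "pd P0" "pd (- lyap_op M P0)" using assms(1) by (auto simp: lyap_stable_def)
  have ne: "UNIV \<noteq> {0 :: real^'n}"
    by (metis UNIV_I axis_eq_0_iff singletonD zero_neq_one)
  obtain v \<mu> where v: "v \<noteq> 0" "v \<bullet> (P *v v) = \<mu> * (v \<bullet> (P0 *v v))"
    "\<And>x. \<mu> * (x \<bullet> (P0 *v x)) \<le> x \<bullet> (P *v x)"
    using rayleigh_min[of UNIV P0 P] ne pdD[OF P0(1)] by auto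
  have "\<mu> \<ge> 0"
  proof (rule ccontr)
    assume "\<not> \<mu> \<ge> 0"
    define N where "N = P - \<mu> *\<^sub>R P0"
    have N: "psd N" unfolding psd_def N_def
      using v(3) by (simp add: sym mat_simps pd_symD[OF P0(1)] vec_simps)
    have "N *v v = 0" by (rule psd_kernel[OF N]) (use v(2) in \<open>simp add: N_def vec_simps\<close>)
    then have "v \<bullet> (lyap_op M N *v v) = 0" using lyap_op_kernel psd_symD[OF N] by blast
    then have "v \<bullet> (lyap_op M P *v v) = \<mu> * (v \<bullet> (lyap_op M P0 *v v))"
      by (simp add: N_def lyap_op_simps vec_simps)
    moreover have "v \<bullet> (lyap_op M P *v v) \<le> 0" "v \<bullet> (lyap_op M P0 *v v) < 0"
      using psdD[OF assms(3), of v] pdD[OF P0(2) v(1)] by (simp_all add: vec_simps)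
    ultimately show False using \<open>\<not> \<mu> \<ge> 0\<close> mult_neg_neg[of \<mu> "v \<bullet> (lyap_op M P0 *v v)"] by linarith
  qed
  then have "0 \<le> x \<bullet> (P *v x)" for x
    using v(3)[of x] psdD[OF pd_imp_psd[OF P0(1)], of x] by (meson mult_nonneg_nonneg order_trans)
  then show ?thesis by (simp add: psd_def sym)
qed

lemma pd_lyap_imp_pd: "psd P \<Longrightarrow> pd (- lyap_op M P) \<Longrightarrow> pd P"
proof (rule psd_imp_pd)
  fix v assume "psd P" "pd (- lyap_op M P)" "P *v v = 0"
  then show "v = 0"
    using lyap_op_kernel[OF psd_symD, of P v M] pdD[of "- lyap_op M P" v] by (auto simp: vec_simps)
qed

lemma lyap_stable_pd: "lyap_stable M \<Longrightarrow> transpose P = P \<Longrightarrow> pd (- lyap_op M P) \<Longrightarrow> pd P"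
  using lyap_comparison pd_imp_psd pd_lyap_imp_pd by blast

lemma lyap_op_inj:
  assumes "lyap_stable M" "transpose P = P" "lyap_op M P = 0" shows "P = 0"
proof (rule psd_antisym)
  show "psd P" by (rule lyap_comparison[OF assms(1,2)]) (simp add: assms(3) psd_0)
  show "psd (- P)"
    by (rule lyap_comparison[OF assms(1)]) (simp_all add: assms(2,3) psd_0 lyap_op_simps mat_simps)
qed

lemma lyap_op_solvable:
  fixes M Q :: "real^'n^'n"
  assumes "lyap_stable M" "transpose Q = Q"
  obtains P where "transpose P = P" "lyap_op M P = Q"
proof -
  \<comment> \<open>Injectivity is known on symmetric matrices only. \<open>g\<close> extends the
    operator to all matrices, applying \<open>lyap_op M\<close> to the symmetric part and the
    identity to the skew part up to factors 2, so that injectivity gives surjectivity by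
    dimension.\<close>
  define g where "g P = lyap_op M (P + transpose P) + (P - transpose P)" for P
  have lin: "linear g"
    by (rule linearI) (simp_all add: g_def lyap_op_simps mat_simps algebra_simps)
  have skew: "g P - transpose (g P) = 2 *\<^sub>R (P - transpose P)" for P
    by (simp add: g_def mat_simps transpose_lyap_op add.commute scaleR_2)
  have "P = 0" if "g P = 0" for P
  proof -
    have "P = transpose P" using skew[of P] that by (simp add: mat_simps)
    then have "lyap_op M (2 *\<^sub>R P) = 0" using that by (simp add: g_def scaleR_2)
    then show "P = 0" using lyap_op_inj[OF assms(1), of "2 *\<^sub>R P"] \<open>P = transpose P\<close>
      by (simp add: mat_simps)
  qed
  then have "surj g" using lin linear_injective_imp_surjective linear_injective_0 by blast
  then obtain P where P: "g P = Q" by (metis surjD)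
  have "P = transpose P" using skew[of P] P assms(2) by simp
  then have "lyap_op M (2 *\<^sub>R P) = Q" using P by (simp add: g_def scaleR_2)
  then show thesis using that[of "2 *\<^sub>R P"] \<open>P = transpose P\<close> by (simp add: mat_simps)
qed

section \<open>Stability and the spectrum\<close>

text \<open>\<open>M\<^sup>T\<close> is skew with respect to the semidefinite form \<open>P\<close>, so maximizing
  \<open>y\<^sup>T M P M\<^sup>T y\<close> relative to \<open>y\<^sup>T P y\<close> produces an eigenvector of \<open>M\<^sup>2\<close>.\<close>

lemma lyap_kernel_eigenvector:
  fixes M P :: "real^'n^'n"
  assumes P: "psd P" and "P \<noteq> 0" and L: "lyap_op M P = 0"
  obtains w \<mu> where "w \<noteq> 0" "\<mu> \<ge> 0" "M *v (M *v w) = - \<mu> *\<^sub>R w"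
proof -
  have sym: "transpose P = P" using P by (rule psd_symD)
  \<comment> \<open>\<open>P\<close> may be singular, but its form is positive on its range, whose
    orthogonal complement is the kernel of \<open>P\<close>.\<close>
  define V where "V = range ((*v) P)"
  have subsp: "subspace V" unfolding V_def
    by (intro linear_subspace_image) auto
  have ker: "P *v x = 0" if "x \<bullet> (P *v (P *v x)) = 0" for x
    using that inner_symmetric[OF sym, of x "P *v x"] by simp
  have pos: "0 < x \<bullet> (P *v x)" if "x \<in> V" "x \<noteq> 0" for x
  proof -
    obtain z where z: "x = P *v z" using \<open>x \<in> V\<close> by (auto simp: V_def)
    have "x \<bullet> (P *v x) \<noteq> 0"
    proof
      assume "x \<bullet> (P *v x) = 0"
      then have "P *v x = 0" by (rule psd_kernel[OF P])
      then have "z \<bullet> (P *v (P *v z)) = 0" by (simp add: z)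
      then show False using ker z that(2) by simp
    qed
    then show ?thesis using psdD[OF P, of x] by simp
  qed
  have "V \<noteq> {0}"
  proof
    assume "V = {0}"
    then have "P *v x = 0" for x by (auto simp: V_def)
    then show False using \<open>P \<noteq> 0\<close> by (simp add: matrix_eq)
  qed
  \<comment> \<open>The kernel equation lets \<open>P\<close> pass through \<open>M\<close> with a
    change of sign, so \<open>G\<close> acts as minus \<open>M\<close> squared after
    \<open>P\<close>. A stationary vector \<open>v\<close> of \<open>G\<close> relative to
    \<open>P\<close> thus yields the eigenvector \<open>P *v v\<close> of the square of
    \<open>M\<close>.\<close>
  define G where "G = M ** P ** transpose M"
  have skew: "P *v (transpose M *v x) = - (M *v (P *v x))" for x
    using arg_cong[OF L, of "\<lambda>Z. Z *v x"]
    by (simp add: lyap_op_def vec_simps eq_neg_iff_add_eq_0 add.commute)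
  obtain v \<nu> where v: "v \<in> V" "v \<noteq> 0" "v \<bullet> (- G *v v) = \<nu> * (v \<bullet> (P *v v))"
    "\<And>x. x \<in> V \<Longrightarrow> \<nu> * (x \<bullet> (P *v x)) \<le> x \<bullet> (- G *v x)"
    using rayleigh_min[OF subsp \<open>V \<noteq> {0}\<close> pos] by blast
  \<comment> \<open>On \<open>V\<close> its form is nonnegative by minimality of
    \<open>\<nu>\<close>; on the complement of \<open>V\<close> both \<open>P\<close> and
    \<open>G\<close> vanish. Hence \<open>N\<close> is psd on the whole space.\<close>
  define N where "N = - (\<nu> *\<^sub>R P) - G"
  have Gsym: "transpose G = G" by (simp add: G_def mat_simps sym)
  have Nsym: "transpose N = N" by (simp add: N_def mat_simps sym Gsym)
  have Gv: "G *v x = - (M *v (M *v (P *v x)))" for x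
    by (simp add: G_def vec_simps skew)
  have N0: "N *v k = 0" if "P *v k = 0" for k
    using that by (simp add: N_def Gv vec_simps)
  have psdN: "psd N"
    unfolding psd_def
  proof (intro conjI allI Nsym)
    fix x
    obtain y k where yk: "y \<in> V" "\<And>w. w \<in> V \<Longrightarrow> orthogonal k w" "x = y + k"
      using orthogonal_subspace_decomp_exists[of V x] span_eq_iff[of V] subsp by metis
    have "k \<bullet> (P *v (P *v k)) = 0"
      using yk(2) by (auto simp: V_def orthogonal_def)
    then have k: "N *v k = 0" by (intro N0 ker)
    have "x \<bullet> (N *v x) = y \<bullet> (N *v y)"
      using k by (simp add: yk(3) vec_simps inner_symmetric[OF Nsym, of k])
    also have "\<dots> \<ge> 0" using v(4)[OF yk(1)] by (simp add: N_def vec_simps)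
    finally show "0 \<le> x \<bullet> (N *v x)" .
  qed
  have "N *v v = 0"
    by (rule psd_kernel[OF psdN]) (use v(3) in \<open>simp add: N_def vec_simps\<close>)
  then have eq: "M *v (M *v (P *v v)) = \<nu> *\<^sub>R (P *v v)" by (simp add: N_def Gv vec_simps)
  have "v \<bullet> (G *v v) \<ge> 0"
    using psdD[OF P, of "transpose M *v v"] inner_transpose[of v "transpose M"] by (simp add: G_def vec_simps)
  then have "\<nu> * (v \<bullet> (P *v v)) \<le> 0" using v(3) by (simp add: vec_simps)
  then have "\<nu> \<le> 0" using pos[OF v(1,2)] by (simp add: mult_le_0_iff)
  moreover have "P *v v \<noteq> 0" using pos[OF v(1,2)] by auto
  ultimately show thesis using that[of "P *v v" "-\<nu>"] eq by simp
qed

text \<open>The certificates \<open>P k\<close> with right-hand side \<open>- mat 1\<close> may blow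
  up, so the pair of certificate and right-hand side is rescaled by \<open>e k\<close> to stay in a
  compact set away from zero. If the limiting factor \<open>el\<close> is positive, the limit is a
  certificate for \<open>M0\<close>. If it is zero, the limit is a nonzero psd solution of the
  homogeneous equation, and \<open>lyap_kernel_eigenvector\<close> contradicts
  \<open>noimag\<close>.\<close>

lemma lyap_stable_limit:
  fixes M :: "nat \<Rightarrow> real^'n^'n"
  assumes lim: "M \<longlonglongrightarrow> M0" and stable: "\<And>k. lyap_stable (M k)"
    and noimag: "\<And>w \<mu>. w \<noteq> 0 \<Longrightarrow> \<mu> \<ge> 0 \<Longrightarrow> M0 *v (M0 *v w) \<noteq> - \<mu> *\<^sub>R w"
  shows "lyap_stable M0"
proof -
  have "\<exists>P. transpose P = P \<and> lyap_op (M k) P = - mat 1" for k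
    using lyap_op_solvable[OF stable, of "- mat 1"] by (metis linear_neg[OF linear_transpose] transpose_mat)
  then obtain P where P: "\<And>k. transpose (P k) = P k" "\<And>k. lyap_op (M k) (P k) = - mat 1" by metis
  have psdP: "psd (P k)" for k
    by (rule lyap_comparison[OF stable[of k] P(1)]) (simp add: P(2) pd_imp_psd[OF pd_mat_1])
  define e where "e k = 1 / (1 + norm (P k))" for k
  have e0: "e k > 0" for k by (simp add: e_def add_pos_nonneg)
  define z where "z k = (e k *\<^sub>R P k, e k)" for k
  have nz: "norm (e k *\<^sub>R P k) + e k = 1" for k
    using e0[of k] by (simp add: e_def field_simps)
  have "z k \<in> cball 0 1 \<times> cball 0 1" for k
    using nz[of k] e0[of k] norm_ge_zero[of "e k *\<^sub>R P k"] unfolding z_def by (simp del: norm_ge_zero)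
  moreover have "compact (cball (0::real^'n^'n) 1 \<times> cball (0::real) 1)"
    by (intro compact_Times compact_cball)
  ultimately obtain l r where r: "strict_mono r" "(z \<circ> r) \<longlonglongrightarrow> l"
    unfolding compact_def by metis
  obtain Pl el where l: "l = (Pl, el)" by fastforce
  have limP: "(\<lambda>k. e (r k) *\<^sub>R P (r k)) \<longlonglongrightarrow> Pl" and lime: "(\<lambda>k. e (r k)) \<longlonglongrightarrow> el"
    using tendsto_fst[OF r(2)] tendsto_snd[OF r(2)] by (simp_all add: l z_def o_def)
  have limM: "(\<lambda>k. M (r k)) \<longlonglongrightarrow> M0" using LIMSEQ_subseq_LIMSEQ[OF lim r(1)] by (simp add: o_def)
  have "(\<lambda>k. lyap_op (M (r k)) (e (r k) *\<^sub>R P (r k))) \<longlonglongrightarrow> lyap_op M0 Pl"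
    by (intro tendsto_lyap_op limM limP)
  then have "(\<lambda>k. - (e (r k) *\<^sub>R mat 1)) \<longlonglongrightarrow> lyap_op M0 Pl" by (simp add: lyap_op_simps P(2))
  moreover have "(\<lambda>k. - (e (r k) *\<^sub>R mat 1)) \<longlonglongrightarrow> - (el *\<^sub>R mat 1 :: real^'n^'n)"
    by (intro tendsto_intros lime)
  ultimately have LP: "lyap_op M0 Pl = - (el *\<^sub>R mat 1)" by (rule LIMSEQ_unique)
  have psdPl: "psd Pl"
    by (rule tendsto_psd[OF limP]) (auto intro!: always_eventually psd_scaleR psdP less_imp_le e0)
  have "(\<lambda>k. norm (e (r k) *\<^sub>R P (r k)) + e (r k)) \<longlonglongrightarrow> norm Pl + el"
    by (intro tendsto_intros limP lime)
  then have "norm Pl + el = 1" unfolding nz using LIMSEQ_unique tendsto_const by blast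
  have "el \<ge> 0" by (rule LIMSEQ_le_const[OF lime]) (use e0 less_imp_le in blast)
  show ?thesis
  proof (cases "el = 0")
    case True
    then have "Pl \<noteq> 0" "lyap_op M0 Pl = 0" using \<open>norm Pl + el = 1\<close> LP by auto
    then show ?thesis using lyap_kernel_eigenvector[OF psdPl] noimag by metis
  next
    case False
    then have "pd (- lyap_op M0 Pl)" using \<open>el \<ge> 0\<close> pd_scaleR[OF pd_mat_1, of el] by (simp add: LP)
    then show ?thesis using pd_lyap_imp_pd[OF psdPl] by (auto simp: lyap_stable_def)
  qed
qed

lemma eventually_lyap_stable:
  fixes M0 :: "real^'n^'n"
  assumes "(M \<longlongrightarrow> M0) F" "lyap_stable M0"
  shows "eventually (\<lambda>t. lyap_stable (M t)) F"
proof -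
  obtain P where P: "pd P" "pd (- lyap_op M0 P)" using assms(2) by (auto simp: lyap_stable_def)
  have "eventually (\<lambda>t. pd (- lyap_op (M t) P)) F"
    by (rule eventually_pd[OF _ P(2)])
      (auto intro!: tendsto_intros tendsto_lyap_op assms simp: mat_simps transpose_lyap_op pd_symD[OF P(1)])
  then show ?thesis by eventually_elim (use P(1) in \<open>auto simp: lyap_stable_def\<close>)
qed

section \<open>Complex eigenvectors written as pairs of real vectors\<close>

definition cvec :: "real^'n \<Rightarrow> real^'n \<Rightarrow> complex^'n" where
  "cvec a b = (\<chi> i. Complex (a $ i) (b $ i))"

lemma cvec_cases: obtains a b where "z = cvec a b"
  by (rule that[of "\<chi> i. Re (z $ i)" "\<chi> i. Im (z $ i)"]) (simp add: cvec_def vec_eq_iff)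

lemma cvec_eq_iff: "cvec a b = cvec c d \<longleftrightarrow> a = c \<and> b = d"
  by (auto simp: cvec_def vec_eq_iff)

lemma cvec_eq_0_iff: "cvec a b = 0 \<longleftrightarrow> a = 0 \<and> b = 0"
  by (auto simp: cvec_def vec_eq_iff complex_eq_iff)

lemma norm_cvec: "(norm (cvec a b))\<^sup>2 = (norm a)\<^sup>2 + (norm b)\<^sup>2"
  by (simp add: cvec_def norm_vec_def L2_set_def sum_nonneg cmod_def sum.distrib)

lemma cmat_cvec: "cmat M *v cvec a b = cvec (M *v a) (M *v b)"
  by (auto simp: cvec_def cmat_def vec_eq_iff matrix_vector_mult_def complex_eq_iff)

lemma mat_cvec: "mat s *v cvec a b = cvec (Re s *\<^sub>R a - Im s *\<^sub>R b) (Re s *\<^sub>R b + Im s *\<^sub>R a)"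
  by (auto simp: cvec_def mat_def vec_eq_iff matrix_vector_mult_def complex_eq_iff
      if_distrib if_distribR sum.delta cong: if_cong)

text \<open>\<open>a + \<i>b\<close> is an eigenvector of \<open>M\<close> for the eigenvalue \<open>\<sigma> + \<i>\<omega>\<close>.\<close>

definition eigenpair :: "real^'n^'n \<Rightarrow> real \<Rightarrow> real \<Rightarrow> real^'n \<Rightarrow> real^'n \<Rightarrow> bool" where
  "eigenpair M \<sigma> \<omega> a b \<longleftrightarrow> (a \<noteq> 0 \<or> b \<noteq> 0) \<and>
     M *v a = \<sigma> *\<^sub>R a - \<omega> *\<^sub>R b \<and> M *v b = \<sigma> *\<^sub>R b + \<omega> *\<^sub>R a"

lemma det_eq_0_iff_eigenpair:
  fixes M :: "real^'n^'n"
  shows "det (mat s - cmat M) = 0 \<longleftrightarrow> (\<exists>a b. eigenpair M (Re s) (Im s) a b)"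
proof -
  have "det (mat s - cmat M) = 0 \<longleftrightarrow> (\<exists>z. z \<noteq> 0 \<and> (mat s - cmat M) *v z = 0)"
    using invertible_det_nz[of "mat s - cmat M"] invertible_left_inverse[of "mat s - cmat M"]
      matrix_left_invertible_ker[of "mat s - cmat M"] by blast
  also have "\<dots> \<longleftrightarrow> (\<exists>a b. cvec a b \<noteq> (0::complex^'n) \<and> (mat s - cmat M) *v cvec a b = 0)"
    by (metis cvec_cases)
  also have "\<dots> \<longleftrightarrow> (\<exists>a b. eigenpair M (Re s) (Im s) a b)"
    by (simp add: matrix_vector_mult_diff_rdistrib mat_cvec cmat_cvec cvec_eq_iff cvec_eq_0_iff
        eigenpair_def eq_commute[of "M *v x" for x])
  finally show ?thesis .
qed

lemma eigenpair_transpose: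
  fixes M :: "real^'n^'n"
  assumes "eigenpair M \<sigma> \<omega> a b"
  obtains c d where "eigenpair (transpose M) \<sigma> \<omega> c d"
proof -
  have "det (mat (Complex \<sigma> \<omega>) - cmat M) = 0"
    using assms det_eq_0_iff_eigenpair[of "Complex \<sigma> \<omega>" M] by auto
  then have "det (transpose (mat (Complex \<sigma> \<omega>) - cmat M)) = 0" by (simp add: det_transpose)
  also have "transpose (mat (Complex \<sigma> \<omega>) - cmat M) = mat (Complex \<sigma> \<omega>) - cmat (transpose M)"
    by (auto simp: cmat_def transpose_def mat_def vec_eq_iff)
  finally show thesis using that det_eq_0_iff_eigenpair[of "Complex \<sigma> \<omega>" "transpose M"] by auto
qed

lemma hurwitz_iff: "hurwitz M \<longleftrightarrow> (\<forall>\<sigma> \<omega> a b. eigenpair M \<sigma> \<omega> a b \<longrightarrow> \<sigma> < 0)"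
  unfolding hurwitz_def det_eq_0_iff_eigenpair by (metis complex.sel)

lemma hurwitz_transpose: "hurwitz M \<Longrightarrow> hurwitz (transpose M)"
  unfolding hurwitz_iff by (metis eigenpair_transpose transpose_transpose)

lemma square_eigenvector_imp_eigenpair:
  assumes "w \<noteq> 0" "\<mu> \<ge> 0" "M *v (M *v w) = - \<mu> *\<^sub>R w"
  obtains \<omega> a b where "eigenpair M 0 \<omega> a b"
proof (cases "M *v w = 0")
  case True
  then show thesis using assms(1) that[of 0 w 0] by (simp add: eigenpair_def)
next
  case False
  \<comment> \<open>The pair encodes \<open>(M + i sqrt \<mu>) w\<close>, which the other factor
    \<open>M - i sqrt \<mu>\<close> of \<open>M M + \<mu>\<close> annihilates.\<close>
  have "eigenpair M 0 (sqrt \<mu>) (M *v w) (sqrt \<mu> *\<^sub>R w)"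
    using False assms(2,3) by (simp add: eigenpair_def vec_simps)
  then show thesis by (rule that)
qed

lemma lyap_stable_limit':
  fixes M0 :: "real^'n^'n"
  assumes "M \<longlonglongrightarrow> M0" "\<And>k. lyap_stable (M k)" "\<And>\<omega> a b. \<not> eigenpair M0 0 \<omega> a b"
  shows "lyap_stable M0"
  using assms(1,2)
proof (rule lyap_stable_limit)
  fix w :: "real^'n" and \<mu> :: real assume "w \<noteq> 0" "\<mu> \<ge> 0"
  then show "M0 *v (M0 *v w) \<noteq> - \<mu> *\<^sub>R w"
    using square_eigenvector_imp_eigenpair[of w \<mu> M0] assms(3) by metis
qed

lemma lyap_stable_imp_hurwitz:
  assumes "lyap_stable M" shows "hurwitz M"
  unfolding hurwitz_iff
proof (intro allI impI)
  fix \<sigma> \<omega> a0 b0 assume "eigenpair M \<sigma> \<omega> a0 b0"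
  \<comment> \<open>The form of \<open>lyap_op M P\<close> applies \<open>transpose M\<close> to its
    argument, so on an eigenvector of the transpose it is \<open>2 * \<sigma>\<close> times the form
    of \<open>P\<close>.\<close>
  then obtain a b where ab: "eigenpair (transpose M) \<sigma> \<omega> a b" by (rule eigenpair_transpose)
  obtain P where P: "pd P" "pd (- lyap_op M P)" using assms by (auto simp: lyap_stable_def)
  have sym: "transpose P = P" using P(1) by (rule pd_symD)
  have q: "x \<bullet> (lyap_op M P *v x) = 2 * ((P *v x) \<bullet> (transpose M *v x))" for x
    by (simp add: lyap_op_quadratic_form[OF sym] inner_transpose)
  have T: "transpose M *v a = \<sigma> *\<^sub>R a - \<omega> *\<^sub>R b" "transpose M *v b = \<sigma> *\<^sub>R b + \<omega> *\<^sub>R a"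
    using ab by (auto simp: eigenpair_def)
  have comm: "(P *v b) \<bullet> a = (P *v a) \<bullet> b"
    by (metis inner_commute inner_symmetric[OF sym])
  have "a \<bullet> (lyap_op M P *v a) + b \<bullet> (lyap_op M P *v b) = 2 * \<sigma> * (a \<bullet> (P *v a) + b \<bullet> (P *v b))"
    using comm unfolding q T by (simp add: vec_simps inner_commute algebra_simps)
  moreover have "a \<bullet> (P *v a) + b \<bullet> (P *v b) > 0"
    using ab pdD[OF P(1)] psdD[OF pd_imp_psd[OF P(1)]]
    by (auto simp: eigenpair_def intro: add_pos_nonneg add_nonneg_pos)
  moreover have "a \<bullet> (- lyap_op M P *v a) + b \<bullet> (- lyap_op M P *v b) > 0"
    using ab pdD[OF P(2)] psdD[OF pd_imp_psd[OF P(2)]]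
    unfolding eigenpair_def by (metis add_pos_nonneg add_nonneg_pos)
  ultimately have "\<sigma> * (a \<bullet> (P *v a) + b \<bullet> (P *v b)) < 0" by (simp add: vec_simps)
  then show "\<sigma> < 0" using \<open>a \<bullet> (P *v a) + b \<bullet> (P *v b) > 0\<close> by (simp add: mult_less_0_iff)
qed

text \<open>Shift the spectrum to the left by \<open>s\<close> and let \<open>s\<close> decrease
  from \<open>norm M + 1\<close>, where the identity is a certificate. At the infimum
  \<open>s0\<close> of the admissible shifts an imaginary eigenvalue would be an eigenvalue of
  \<open>M\<close> with real part \<open>s0 \<ge> 0\<close>, so stability persists in the limit; as
  it is open, \<open>s0\<close> cannot be positive.\<close>

lemma hurwitz_imp_lyap_stable:
  fixes M :: "real^'n^'n"
  assumes "hurwitz M" shows "lyap_stable M"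
proof -
  define T where "T = {s. s \<ge> 0 \<and> lyap_stable (M - s *\<^sub>R mat 1)}"
  define s1 where "s1 = norm M + 1"
  have "pd (- lyap_op (M - s1 *\<^sub>R mat 1) (mat 1))"
    unfolding pd_def
  proof (intro conjI allI impI)
    show "transpose (- lyap_op (M - s1 *\<^sub>R mat 1) (mat 1)) = - lyap_op (M - s1 *\<^sub>R mat 1) (mat 1)"
      by (simp add: mat_simps transpose_lyap_op)
    fix x :: "real^'n" assume "x \<noteq> 0"
    have "x \<bullet> (M *v x) \<le> norm M * (norm x)\<^sup>2" by (rule quadratic_form_le)
    also have "\<dots> < s1 * (x \<bullet> x)" using \<open>x \<noteq> 0\<close> by (simp add: s1_def dot_square_norm)
    finally show "0 < x \<bullet> (- lyap_op (M - s1 *\<^sub>R mat 1) (mat 1) *v x)"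
      using lyap_op_quadratic_form[of "mat 1" x "M - s1 *\<^sub>R mat 1" x]
      by (simp add: vec_simps inner_commute)
  qed
  then have "s1 \<in> T" using pd_mat_1 by (auto simp: T_def s1_def lyap_stable_def)
  have bdd: "bdd_below T" by (auto simp: T_def)
  define s0 where "s0 = Inf T"
  have "s0 \<in> closure T" unfolding s0_def using \<open>s1 \<in> T\<close> bdd by (intro closure_contains_Inf) auto
  then obtain f where f: "\<And>k. f k \<in> T" "f \<longlonglongrightarrow> s0" using closure_sequential[of s0 T] by blast
  have "s0 \<ge> 0" by (rule LIMSEQ_le_const[OF f(2)]) (use f(1) T_def in blast)
  have st: "lyap_stable (M - s0 *\<^sub>R mat 1)"
  proof (rule lyap_stable_limit')
    show "(\<lambda>k. M - f k *\<^sub>R mat 1) \<longlonglongrightarrow> M - s0 *\<^sub>R mat 1" by (intro tendsto_intros f)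
    show "lyap_stable (M - f k *\<^sub>R mat 1)" for k using f(1) by (auto simp: T_def)
    fix \<omega> a b
    show "\<not> eigenpair (M - s0 *\<^sub>R mat 1) 0 \<omega> a b"
    proof
      assume "eigenpair (M - s0 *\<^sub>R mat 1) 0 \<omega> a b"
      then have "eigenpair M s0 \<omega> a b"
        unfolding eigenpair_def by (simp add: vec_simps diff_eq_eq add.commute)
      then show False using assms \<open>s0 \<ge> 0\<close> unfolding hurwitz_iff by fastforce
    qed
  qed
  have "s0 = 0"
  proof (rule ccontr)
    assume "s0 \<noteq> 0" then have "s0 > 0" using \<open>s0 \<ge> 0\<close> by simp
    have "eventually (\<lambda>s. lyap_stable (M - s *\<^sub>R mat 1)) (at_left s0)"
      by (rule eventually_lyap_stable[OF _ st]) (intro tendsto_intros)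
    moreover have "eventually (\<lambda>s. s \<in> {0<..<s0}) (at_left s0)"
      using \<open>s0 > 0\<close> by (rule eventually_at_left_real)
    ultimately have "eventually (\<lambda>s. s \<in> T \<and> s < s0) (at_left s0)"
      by eventually_elim (auto simp: T_def)
    then have "\<exists>s. s \<in> T \<and> s < s0" by (rule eventually_happens'[OF trivial_limit_at_left_real])
    then obtain s where "s \<in> T" "s < s0" by blast
    then show False using cInf_lower[OF _ bdd] by (fastforce simp: s0_def)
  qed
  then show ?thesis using st by simp
qed

lemma hurwitz_iff_lyap_stable: "hurwitz M \<longleftrightarrow> lyap_stable M"
  using hurwitz_imp_lyap_stable lyap_stable_imp_hurwitz by blast

section \<open>The Riccati equation\<close>

text \<open>\<open>S\<close> absorbs the factor in front of the quadratic term. With the plus sign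
  and \<open>S\<close> psd the operator is matrix convex in \<open>X\<close>.\<close>

definition ric :: "real^'n^'n \<Rightarrow> real^'n^'n \<Rightarrow> real^'n^'n \<Rightarrow> real^'n^'n \<Rightarrow> real^'n^'n" where
  "ric A S W X = lyap_op A X + X ** S ** X + W"

lemma transpose_ric:
  "transpose S = S \<Longrightarrow> transpose W = W \<Longrightarrow> transpose X = X \<Longrightarrow> transpose (ric A S W X) = ric A S W X"
  by (simp add: ric_def mat_simps transpose_lyap_op)

text \<open>The exact second-order expansion of \<open>ric\<close> at \<open>X\<close>: its
  derivative there is \<open>lyap_op (A + X ** S)\<close>, and for psd \<open>S\<close> the
  remainder has a sign. Newton's method and all comparisons rest on this.\<close>

lemma ric_diff:
  assumes "transpose S = S" "transpose X = X"
  shows "lyap_op (A + X ** S) (Y - X) = ric A S W Y - ric A S W X - (Y - X) ** S ** (Y - X)"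
  by (simp add: ric_def lyap_op_def mat_simps assms)

lemma tendsto_ric:
  assumes "(A \<longlongrightarrow> A0) F" "(S \<longlongrightarrow> S0) F" "(X \<longlongrightarrow> X0) F"
  shows "((\<lambda>t. ric (A t) (S t) W (X t)) \<longlongrightarrow> ric A0 S0 W X0) F"
  unfolding ric_def by (intro tendsto_intros tendsto_lyap_op tendsto_matrix_mult assms)

lemma psd_sandwich: "psd S \<Longrightarrow> transpose X = X \<Longrightarrow> psd (X ** S ** X)"
  using psd_congruence[of S X] by simp

lemma symmetric_entry: "transpose M = M \<Longrightarrow> M $ j $ i = M $ i $ j"
  by (drule arg_cong[of _ _ "\<lambda>M. M $ i $ j"]) (simp add: transpose_def)

lemma psd_monotone_convergent:
  fixes X :: "nat \<Rightarrow> real^'n^'n"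
  assumes sym: "\<And>k. transpose (X k) = X k" and mono: "\<And>k. psd (X (Suc k) - X k)"
    and bound: "\<And>k. psd (B - X k)"
  obtains L where "X \<longlonglongrightarrow> L"
proof -
  have conv: "convergent (\<lambda>k. x \<bullet> (X k *v x))" for x
  proof (rule Bseq_monoseq_convergent[OF _ ])
    have inc: "incseq (\<lambda>k. x \<bullet> (X k *v x))"
      using psdD[OF mono] by (intro incseq_SucI) (simp add: vec_simps)
    then show "monoseq (\<lambda>k. x \<bullet> (X k *v x))" by (simp add: incseq_imp_monoseq)
    show "Bseq (\<lambda>k. x \<bullet> (X k *v x))"
    proof (rule BseqI')
      fix k
      have "x \<bullet> (X 0 *v x) \<le> x \<bullet> (X k *v x)" using incseqD[OF inc, of 0 k] by simp
      moreover have "x \<bullet> (X k *v x) \<le> x \<bullet> (B *v x)" using psdD[OF bound, of x k] by (simp add: vec_simps)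
      ultimately show "norm (x \<bullet> (X k *v x)) \<le> max \<bar>x \<bullet> (X 0 *v x)\<bar> \<bar>x \<bullet> (B *v x)\<bar>" by auto
    qed
  qed
  \<comment> \<open>Polarization recovers the entries from the quadratic forms, which converge as
    bounded monotone sequences.\<close>
  have entry: "X k $ i $ j = ((axis i 1 + axis j 1) \<bullet> (X k *v (axis i 1 + axis j 1))
      - axis i 1 \<bullet> (X k *v axis i 1) - axis j 1 \<bullet> (X k *v axis j 1)) * (1 / 2)" for k i j
  proof -
    have "axis i 1 \<bullet> (X k *v axis j 1) = X k $ i $ j" for i j
      by (simp add: inner_axis' matrix_vector_mult_basis column_def)
    moreover have "X k $ j $ i = X k $ i $ j" by (rule symmetric_entry[OF sym])
    ultimately show ?thesis by (simp add: vec_simps)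
  qed
  have "convergent (\<lambda>k. X k $ i $ j)" for i j
    unfolding entry by (intro convergent_diff convergent_mult conv convergent_const)
  then have "(\<lambda>k. X k $ i $ j) \<longlonglongrightarrow> lim (\<lambda>k. X k $ i $ j)" for i j
    by (simp add: convergent_LIMSEQ_iff)
  then have "X \<longlonglongrightarrow> (\<chi> i j. lim (\<lambda>k. X k $ i $ j))"
    by (intro vec_tendstoI) simp
  then show thesis by (rule that)
qed

text \<open>Newton's method started at \<open>0\<close> increases to a solution below the strict supersolution.\<close>

lemma ric_stabilizing_solution:
  fixes A S W U :: "real^'n^'n"
  assumes S: "psd S" and W: "psd W" and U: "pd U" "pd (- ric A S W U)"
  obtains X where "transpose X = X" "ric A S W X = 0" "lyap_stable (A + X ** S)"
proof -
  have Ssym: "transpose S = S" and Usym: "transpose U = U" and Wsym: "transpose W = W"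
    using S U(1) W by (auto simp: psd_symD pd_symD)
  define good where "good X \<longleftrightarrow> transpose X = X \<and> lyap_stable (A + X ** S) \<and> psd (ric A S W X)" for X
  have "good 0"
  proof -
    have "- lyap_op A U = - ric A S W U + (U ** S ** U + W)" by (simp add: ric_def)
    moreover have "pd (- ric A S W U + (U ** S ** U + W))"
      by (intro pd_add_psd psd_add psd_sandwich U S W Usym)
    ultimately have "pd (- lyap_op A U)" by simp
    then show ?thesis using U(1) W
      by (auto simp: good_def mat_simps ric_def lyap_op_simps lyap_stable_def)
  qed
  have step: "\<exists>Y. good Y \<and> psd (Y - X) \<and> psd (U - Y) \<and> ric A S W Y = (Y - X) ** S ** (Y - X)"
    if "good X" for X
  proof -
    have X: "transpose X = X" "lyap_stable (A + X ** S)" "psd (ric A S W X)"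
      using that by (auto simp: good_def)
    \<comment> \<open>\<open>D\<close> is the Newton correction. By \<open>ric_diff\<close> the new
      residual is exactly \<open>D ** S ** D\<close>, again psd, so the next correction is also
      upward.\<close>
    obtain D where D: "transpose D = D" "lyap_op (A + X ** S) D = - ric A S W X"
      using lyap_op_solvable[OF X(2), of "- ric A S W X"] psd_symD[OF X(3)] by (auto simp: mat_simps)
    define Y where "Y = X + D"
    have Y: "transpose Y = Y" by (simp add: Y_def mat_simps X D)
    have "psd D" by (rule lyap_comparison[OF X(2) D(1)]) (simp add: D(2) X(3))
    have ricY: "ric A S W Y = D ** S ** D"
      using ric_diff[OF Ssym X(1), of A Y W] by (simp add: Y_def D(2))
    have pY: "psd (ric A S W Y)" unfolding ricY by (rule psd_sandwich[OF S D(1)])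
    have "lyap_op (A + X ** S) (U - Y) = lyap_op (A + X ** S) (U - X) - lyap_op (A + X ** S) D"
      by (simp add: Y_def lyap_op_simps)
    also have "\<dots> = ric A S W U - (U - X) ** S ** (U - X)"
      by (simp add: ric_diff[OF Ssym X(1), of A U W] D(2))
    finally have "- lyap_op (A + X ** S) (U - Y) = - ric A S W U + (U - X) ** S ** (U - X)" by simp
    moreover have "pd (- ric A S W U + (U - X) ** S ** (U - X))"
      by (intro pd_add_psd U psd_sandwich S) (simp add: mat_simps Usym X)
    ultimately have "pd (- lyap_op (A + X ** S) (U - Y))" by simp
    then have pd: "pd (U - Y)"
      using lyap_stable_pd[OF X(2), of "U - Y"] by (simp add: mat_simps Usym Y)
    \<comment> \<open>The gap \<open>U - Y\<close> to the supersolution is itself the Lyapunov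
      certificate for the next Newton step.\<close>
    have "- lyap_op (A + Y ** S) (U - Y) = - ric A S W U + (ric A S W Y + (U - Y) ** S ** (U - Y))"
      by (simp add: ric_diff[OF Ssym Y, of A U W])
    moreover have "psd (ric A S W Y + (U - Y) ** S ** (U - Y))"
      using pY by (intro psd_add psd_sandwich[OF S]) (auto simp: mat_simps Y Usym)
    ultimately have "pd (- lyap_op (A + Y ** S) (U - Y))" using U(2) pd_add_psd by metis
    then have "lyap_stable (A + Y ** S)" using pd by (auto simp: lyap_stable_def)
    then show ?thesis using Y pY \<open>psd D\<close> pd_imp_psd[OF pd] ricY
      by (intro exI[of _ Y]) (simp add: good_def Y_def)
  qed
  obtain X where X: "\<And>k. good (X k)" "\<And>k. psd (X (Suc k) - X k) \<and> psd (U - X (Suc k)) \<and>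
      ric A S W (X (Suc k)) = (X (Suc k) - X k) ** S ** (X (Suc k) - X k)"
    using dependent_nat_choice[of "\<lambda>_. good" "\<lambda>_ X Y. psd (Y - X) \<and> psd (U - Y) \<and> ric A S W Y = (Y - X) ** S ** (Y - X)"]
      \<open>good 0\<close> step by metis
  have Xsym: "transpose (X k) = X k" for k using X(1) by (simp add: good_def)
  obtain L where L: "(\<lambda>k. X (Suc k)) \<longlonglongrightarrow> L"
    by (rule psd_monotone_convergent[of "\<lambda>k. X (Suc k)" U]) (simp_all add: X(2) Xsym)
  then have L': "X \<longlonglongrightarrow> L" by (rule LIMSEQ_imp_Suc)
  have psdUL: "psd (U - L)"
    by (rule tendsto_psd[of "\<lambda>k. U - X (Suc k)" _ sequentially]) (use X(2) in \<open>auto intro!: tendsto_intros L\<close>)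
  have Lsym: "transpose L = L"
    using LIMSEQ_unique[OF tendsto_transpose[OF L']] L' by (simp add: Xsym)
  have "ric A S W (X (Suc k)) = (X (Suc k) - X k) ** S ** (X (Suc k) - X k)" for k
    using X(2) by blast
  moreover have "(\<lambda>k. (X (Suc k) - X k) ** S ** (X (Suc k) - X k)) \<longlonglongrightarrow> (L - L) ** S ** (L - L)"
    by (intro tendsto_diff tendsto_matrix_mult tendsto_const L L')
  ultimately have "(\<lambda>k. ric A S W (X (Suc k))) \<longlonglongrightarrow> (L - L) ** S ** (L - L)" by simp
  moreover have "(\<lambda>k. ric A S W (X (Suc k))) \<longlonglongrightarrow> ric A S W L" by (intro tendsto_ric tendsto_const L)
  ultimately have ricL: "ric A S W L = 0" using LIMSEQ_unique by (fastforce simp: mat_simps)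
  \<comment> \<open>The limit only leaves \<open>U - L\<close> psd. Strictness of the supersolution
    makes the Lyapunov image definite, and this makes \<open>U - L\<close> a certificate.\<close>
  have "- lyap_op (A + L ** S) (U - L) = - ric A S W U + (U - L) ** S ** (U - L)"
    by (simp add: ric_diff[OF Ssym Lsym, of A U W] ricL)
  moreover have "pd (- ric A S W U + (U - L) ** S ** (U - L))"
    by (intro pd_add_psd U psd_sandwich S) (simp add: mat_simps Usym Lsym)
  ultimately have pd: "pd (- lyap_op (A + L ** S) (U - L))" by simp
  then have "lyap_stable (A + L ** S)"
    using pd_lyap_imp_pd[OF psdUL pd] by (auto simp: lyap_stable_def)
  then show thesis using that Lsym ricL by blast
qed

text \<open>Both the defect of the supersolution and the remainder in \<open>ric_diff\<close> push
  \<open>- lyap_op (A + X ** S) (Y - X)\<close> upwards. No stability is asked at \<open>Y\<close>,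
  so points of a segment between solutions can be inserted.\<close>

lemma ric_comparison:
  assumes S: "psd S" and X: "transpose X = X" "ric A S W X = 0" "lyap_stable (A + X ** S)"
    and Y: "transpose Y = Y" "psd (- ric A S W Y)"
  shows "psd (Y - X)"
proof (rule lyap_comparison[OF X(3)])
  show sym: "transpose (Y - X) = Y - X" by (simp add: mat_simps X Y)
  have "- lyap_op (A + X ** S) (Y - X) = - ric A S W Y + (Y - X) ** S ** (Y - X)"
    by (simp add: ric_diff[OF psd_symD[OF S] X(1), of A Y W] X(2))
  moreover have "psd (- ric A S W Y + (Y - X) ** S ** (Y - X))"
    by (intro psd_add Y psd_sandwich S sym)
  ultimately show "psd (- lyap_op (A + X ** S) (Y - X))" by simp
qed

lemma ric_stabilizing_unique:
  assumes "psd S" "transpose X = X" "ric A S W X = 0" "lyap_stable (A + X ** S)"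
    "transpose Y = Y" "ric A S W Y = 0" "lyap_stable (A + Y ** S)"
  shows "X = Y"
proof -
  have "psd (Y - X)" "psd (X - Y)"
    using ric_comparison[of S X A W Y] ric_comparison[of S Y A W X] assms psd_0 by auto
  then show ?thesis using psd_antisym[of "Y - X"] by simp
qed

lemma ric_strict_supersolution:
  assumes S: "psd S" and X: "psd X" "ric A S W X = 0" "lyap_stable (A + X ** S)" and W: "transpose W = W"
  obtains U where "pd U" "pd (- ric A S W U)"
proof -
  obtain P where P: "pd P" "pd (- lyap_op (A + X ** S) P)" using X(3) by (auto simp: lyap_stable_def)
  \<comment> \<open>This is the negative residual at \<open>X + e *\<^sub>R P\<close> divided by
    \<open>e\<close>: a definite first-order term and a correction that vanishes with
    \<open>e\<close>.\<close>
  define G where "G e = - lyap_op (A + X ** S) P - e *\<^sub>R (P ** S ** P)" for e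
  have "eventually (\<lambda>e. pd (G e)) (at_right 0)"
  proof (rule eventually_pd[OF _ P(2)])
    have "(G \<longlongrightarrow> - lyap_op (A + X ** S) P - 0 *\<^sub>R (P ** S ** P)) (at_right 0)"
      unfolding G_def by (intro tendsto_intros)
    then show "(G \<longlongrightarrow> - lyap_op (A + X ** S) P) (at_right 0)" by simp
    show "eventually (\<lambda>e. transpose (G e) = G e) (at_right 0)"
      by (simp add: G_def mat_simps transpose_lyap_op pd_symD[OF P(1)] psd_symD[OF S])
  qed
  moreover have "eventually (\<lambda>e. (0::real) < e) (at_right 0)" by (rule eventually_at_right_less)
  ultimately have "eventually (\<lambda>e. pd (G e) \<and> 0 < e) (at_right 0)" by eventually_elim simp
  then have "\<exists>e. pd (G e) \<and> 0 < e" by (rule eventually_happens'[OF trivial_limit_at_right_real])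
  then obtain e where e: "pd (G e)" "0 < e" by blast
  show thesis
  proof
    show "pd (X + e *\<^sub>R P)" by (intro psd_add_pd X pd_scaleR P e)
    have "- ric A S W (X + e *\<^sub>R P) = e *\<^sub>R G e"
      using ric_diff[OF psd_symD[OF S] psd_symD[OF X(1)], of A "X + e *\<^sub>R P" W]
      by (simp add: X(2) G_def lyap_op_simps mat_simps algebra_simps)
    then show "pd (- ric A S W (X + e *\<^sub>R P))" using e by (simp add: pd_scaleR)
  qed
qed

section \<open>Square roots and traces\<close>

text \<open>With \<open>A = -I\<close> and \<open>S = I\<close> the Riccati equation reads \<open>(I - X)\<^sup>2 = I - W\<close>.\<close>

lemma pd_sqrt_exists:
  fixes M :: "real^'n^'n"
  assumes "pd M"
  obtains R where "pd R" "R ** R = M"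
proof -
  \<comment> \<open>The scaling puts \<open>c *\<^sub>R M\<close> below the identity, so that
    \<open>W\<close> is psd.\<close>
  define c where "c = 1 / (norm M + 1)"
  have c: "c > 0" by (simp add: c_def add_nonneg_pos)
  define W where "W = mat 1 - c *\<^sub>R M"
  have Msym: "transpose M = M" using assms by (rule pd_symD)
  have W: "psd W"
    unfolding psd_def
  proof (intro conjI allI)
    show "transpose W = W" by (simp add: W_def mat_simps Msym)
    fix x
    have "c * (x \<bullet> (M *v x)) \<le> c * (norm M * (norm x)\<^sup>2)"
      using c by (intro mult_left_mono quadratic_form_le) auto
    also have "\<dots> \<le> x \<bullet> x"
      using add_nonneg_pos[OF norm_ge_zero zero_less_one, of M]
      by (simp add: c_def dot_square_norm divide_simps algebra_simps)
    finally show "0 \<le> x \<bullet> (W *v x)" by (simp add: W_def vec_simps)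
  qed
  have "- ric (- mat 1) (mat 1) W (mat 1) = c *\<^sub>R M"
    by (simp add: ric_def lyap_op_def mat_simps W_def)
  then have "pd (- ric (- mat 1) (mat 1) W (mat 1))" using pd_scaleR[OF assms c] by simp
  then obtain X where X: "transpose X = X" "ric (- mat 1) (mat 1) W X = 0"
      "lyap_stable (- mat 1 + X ** mat 1)"
    by (rule ric_stabilizing_solution[OF pd_imp_psd[OF pd_mat_1] W pd_mat_1])
  \<comment> \<open>The matrix stabilized by \<open>X\<close> is \<open>- R\<close>; this selects
    the positive root among the solutions of \<open>R ** R = c *\<^sub>R M\<close>.\<close>
  define R where "R = mat 1 - X"
  have Rsym: "transpose R = R" by (simp add: R_def mat_simps X(1))
  have RR: "R ** R = c *\<^sub>R M"
    using X(2) by (simp add: lyap_op_def ric_def R_def W_def mat_simps X(1) algebra_simps)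
  have L: "- lyap_op (- R) R = c *\<^sub>R M + c *\<^sub>R M"
    by (simp add: lyap_op_def mat_simps Rsym RR)
  have "lyap_stable (- R)" using X(3) by (simp add: R_def)
  then have "pd R"
  proof (rule lyap_stable_pd[OF _ Rsym])
    show "pd (- lyap_op (- R) R)"
      unfolding L using pd_scaleR[OF assms c] by (blast intro: pd_add_psd pd_imp_psd)
  qed
  show thesis
  proof
    show "pd ((1 / sqrt c) *\<^sub>R R)" using \<open>pd R\<close> c by (simp add: pd_scaleR)
    show "(1 / sqrt c) *\<^sub>R R ** (1 / sqrt c) *\<^sub>R R = M"
      using c by (simp add: mat_simps RR real_sqrt_mult[symmetric])
  qed
qed

text \<open>The difference \<open>R - T\<close> solves the homogeneous Lyapunov equation of
  \<open>- (R + T)\<close>, because the products of sum and difference add up to twice the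
  difference of the squares.\<close>

lemma psd_sqrt_unique:
  assumes "pd M" "psd R" "R ** R = M" "psd T" "T ** T = M"
  shows "R = T"
proof -
  have "pd R"
    by (rule psd_imp_pd[OF assms(2)]) (use assms(3) pdD[OF assms(1)] in
      \<open>metis inner_zero_right less_irrefl matrix_vector_mul_assoc matrix_vector_mult_0_right\<close>)
  then have pd: "pd (R + T)" using assms(4) by (rule pd_add_psd)
  have sym: "transpose R = R" "transpose T = T" using assms psd_symD by auto
  have "lyap_op (- (R + T)) (mat 1) = - 2 *\<^sub>R (R + T)"
    by (simp add: lyap_op_def mat_simps sym scaleR_2)
  then have "lyap_stable (- (R + T))"
    unfolding lyap_stable_def using pd pd_mat_1 by (metis pd_scaleR minus_minus scaleR_minus_left zero_less_numeral)
  then have "R - T = 0"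
    by (rule lyap_op_inj) (simp_all add: mat_simps sym lyap_op_def assms(3,5))
  then show ?thesis by simp
qed

lemma psd_sqrt_square:
  assumes "pd M"
  shows "transpose (psd_sqrt M) = psd_sqrt M" "psd_sqrt M ** psd_sqrt M = M"
proof -
  obtain R where R: "pd R" "R ** R = M" using assms by (rule pd_sqrt_exists)
  have "psd_sqrt M = R" unfolding psd_sqrt_def
    by (rule the_equality) (use R pd_imp_psd psd_sqrt_unique[OF assms] in auto)
  then show "transpose (psd_sqrt M) = psd_sqrt M" "psd_sqrt M ** psd_sqrt M = M"
    using R by (auto simp: pd_symD)
qed

lemma trace_scaleR: "trace (c *\<^sub>R M) = c * trace M" for M :: "real^'n^'n"
  by (simp add: trace_def sum_distrib_left)

lemma trace_nonneg: "psd M \<Longrightarrow> 0 \<le> trace M"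
  unfolding trace_def
proof (rule sum_nonneg)
  fix i assume "psd M"
  then have "0 \<le> axis i 1 \<bullet> (M *v axis i 1)" by (rule psdD)
  then show "0 \<le> M $ i $ i" by (simp add: inner_axis' matrix_vector_mult_basis column_def)
qed

lemma trace_mult_psd_pd:
  assumes "psd P" "pd X" shows "0 \<le> trace (P ** X)"
proof -
  obtain R where R: "pd R" "R ** R = X" using assms(2) by (rule pd_sqrt_exists)
  have "trace (P ** X) = trace (P ** R ** R)" by (simp add: R(2)[symmetric] matrix_mul_assoc)
  also have "\<dots> = trace (R ** P ** R)" using trace_mul_sym[of "P ** R" R] by (simp add: matrix_mul_assoc)
  finally show ?thesis using trace_nonneg[OF psd_sandwich[OF assms(1) pd_symD[OF R(1)]]] by simp
qed

lemma trace_mult_psd: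
  assumes "psd P" "psd X" shows "0 \<le> trace (P ** X)"
proof (rule field_le_epsilon)
  fix e :: real assume e: "e > 0"
  \<comment> \<open>Adding \<open>d *\<^sub>R mat 1\<close> makes the second factor definite, so it
    has a root, and costs at most \<open>e\<close>. The 1 allows \<open>trace P = 0\<close>.\<close>
  define d where "d = e / (trace P + 1)"
  have p: "trace P + 1 > 0" using trace_nonneg[OF assms(1)] by simp
  then have d: "d > 0" using e by (simp add: d_def)
  have "0 \<le> trace (P ** (X + d *\<^sub>R mat 1))"
    by (intro trace_mult_psd_pd psd_add_pd pd_scaleR pd_mat_1 assms d)
  also have "\<dots> = trace (P ** X) + d * trace P" by (simp add: mat_simps trace_add trace_scaleR)
  also have "d * trace P \<le> e" using p e by (simp add: d_def field_simps)
  finally show "0 \<le> trace (P ** X) + e" by simp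
qed

section \<open>The strict bounded real lemma\<close>

lemma trace_mult_symmetric: "transpose X = X \<Longrightarrow> trace (A ** X) = A \<bullet> X" for X :: "real^'n^'n"
proof -
  assume "transpose X = X"
  then have "X $ j $ i = X $ i $ j" for i j by (rule symmetric_entry)
  then show ?thesis by (simp add: trace_def matrix_matrix_mult_def inner_vec_def)
qed

text \<open>\<open>\<tau> c\<parallel>X\<parallel>\<^sup>2 \<le> \<tau> tr (X S X) \<le> -2 tr (A X) \<le> 2\<parallel>A\<parallel>\<parallel>X\<parallel>\<close>.\<close>

lemma ric_solution_bound:
  fixes A S W X :: "real^'n^'n"
  assumes S: "\<And>x. c * (norm x)\<^sup>2 \<le> x \<bullet> (S *v x)" and W: "psd W"
    and X: "transpose X = X" "ric A (\<tau> *\<^sub>R S) W X = 0" and \<tau>: "\<tau> \<ge> 0"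
  shows "\<tau> * c * norm X \<le> 2 * norm A"
proof -
  have Xij: "X $ j $ i = X $ i $ j" for i j by (rule symmetric_entry[OF X(1)])
  have "(X ** S ** X) $ i $ i = (X $ i) \<bullet> (S *v (X $ i))" for i
  proof -
    have "(X ** S ** X) $ i $ i = axis i 1 \<bullet> ((X ** S ** X) *v axis i 1)"
      by (simp add: inner_axis' matrix_vector_mult_basis column_def)
    also have "\<dots> = (X *v axis i 1) \<bullet> (S *v (X *v axis i 1))"
      by (simp add: vec_simps inner_symmetric[OF X(1)])
    also have "X *v axis i 1 = X $ i" by (simp add: matrix_vector_mult_basis column_def vec_eq_iff Xij)
    finally show ?thesis .
  qed
  then have "trace (X ** S ** X) = (\<Sum>i\<in>UNIV. (X $ i) \<bullet> (S *v (X $ i)))" by (simp add: trace_def)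
  also have "\<dots> \<ge> (\<Sum>i\<in>UNIV. c * (norm (X $ i))\<^sup>2)" by (intro sum_mono S)
  also have "(\<Sum>i\<in>UNIV. c * (norm (X $ i))\<^sup>2) = c * (norm X)\<^sup>2"
    by (simp add: norm_vec_def[of X] L2_set_def sum_nonneg sum_distrib_left)
  finally have 1: "c * (norm X)\<^sup>2 \<le> trace (X ** S ** X)" .
  have "trace (ric A (\<tau> *\<^sub>R S) W X) = trace (0 :: real^'n^'n)"
    unfolding X(2) by simp
  moreover have "trace (X ** transpose A) = trace (A ** X)"
  proof -
    have "trace (X ** transpose A) = trace (transpose (A ** X))" by (simp add: mat_simps X)
    then show ?thesis by (simp add: trace_def transpose_def)
  qed
  ultimately have "2 * trace (A ** X) + \<tau> * trace (X ** S ** X) + trace W = 0"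
    by (simp add: ric_def lyap_op_def trace_add mat_simps trace_scaleR trace_def[of 0])
  then have "\<tau> * trace (X ** S ** X) \<le> - (2 * trace (A ** X))" using trace_nonneg[OF W] by simp
  also have "\<dots> \<le> 2 * norm A * norm X"
    using Cauchy_Schwarz_ineq2[of A X] by (simp add: trace_mult_symmetric[OF X(1)] abs_le_iff)
  finally have "(\<tau> * c * norm X) * norm X \<le> (2 * norm A) * norm X"
    using mult_left_mono[OF 1 \<tau>] by (simp add: power2_eq_square mult_ac)
  then show ?thesis
    by (cases "X = 0") (auto simp: mult_le_cancel_right)
qed

text \<open>For \<open>\<tau> = 0\<close> the equation is a Lyapunov equation with a strict
  supersolution. At the supremum \<open>\<sigma>\<close> of the parameters reached, the stabilizing
  solutions have a limit point, which is stabilizing by \<open>gap\<close>. It yields a strict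
  supersolution at \<open>\<sigma>\<close>, which would carry over to larger parameters unless
  \<open>\<sigma> = \<tau>1\<close>.\<close>

lemma ric_homotopy:
  fixes A S W :: "real^'n^'n"
  assumes A: "lyap_stable A" and S: "pd S" and W: "psd W" and \<tau>1: "\<tau>1 > 0"
    and gap: "\<And>\<tau> X \<omega> a b. 0 < \<tau> \<Longrightarrow> \<tau> \<le> \<tau>1 \<Longrightarrow> transpose X = X \<Longrightarrow> ric A (\<tau> *\<^sub>R S) W X = 0 \<Longrightarrow>
      \<not> eigenpair (A + X ** (\<tau> *\<^sub>R S)) 0 \<omega> a b"
  obtains X where "transpose X = X" "ric A (\<tau>1 *\<^sub>R S) W X = 0" "lyap_stable (A + X ** (\<tau>1 *\<^sub>R S))"
proof -
  \<comment> \<open>Zero is excluded since the norm bound for solutions degenerates there.\<close>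
  define T where "T = {\<tau>. 0 < \<tau> \<and> \<tau> \<le> \<tau>1 \<and> (\<exists>U. pd U \<and> pd (- ric A (\<tau> *\<^sub>R S) W U))}"
  have Wsym: "transpose W = W" using W by (rule psd_symD)
  have psdS: "psd (\<tau> *\<^sub>R S)" if "\<tau> \<ge> 0" for \<tau> using psd_scaleR[OF pd_imp_psd[OF S] that] .
  have open_T: "eventually (\<lambda>s. \<exists>U. pd U \<and> pd (- ric A (s *\<^sub>R S) W U)) F"
    if U: "pd U" "pd (- ric A (\<tau> *\<^sub>R S) W U)" and F: "((\<lambda>s. s) \<longlongrightarrow> \<tau>) F" for U \<tau> F
  proof -
    have "eventually (\<lambda>s. pd (- ric A (s *\<^sub>R S) W U)) F"
      by (rule eventually_pd[OF _ U(2)])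
        (auto intro!: tendsto_intros tendsto_ric F
          simp: mat_simps transpose_ric pd_symD[OF U(1)] pd_symD[OF S] Wsym)
    then show ?thesis by eventually_elim (use U(1) in blast)
  qed
  have "\<exists>s. s \<in> T"
  proof -
    obtain U where U: "transpose U = U" "lyap_op A U = - (W + mat 1)"
      using lyap_op_solvable[OF A, of "- (W + mat 1)"] by (auto simp: mat_simps Wsym)
    have "pd (W + mat 1)" by (rule psd_add_pd[OF W pd_mat_1])
    then have "pd U" by (intro lyap_stable_pd[OF A U(1)]) (simp add: U(2) add.commute)
    moreover have "pd (- ric A (0 *\<^sub>R S) W U)" by (simp add: ric_def U(2) bounded_bilinear.zero_left[OF bounded_bilinear_matrix_mult]
          bounded_bilinear.zero_right[OF bounded_bilinear_matrix_mult] pd_mat_1)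
    ultimately have "eventually (\<lambda>s. \<exists>U. pd U \<and> pd (- ric A (s *\<^sub>R S) W U)) (at_right 0)"
      by (rule open_T) (rule tendsto_ident_at)
    moreover have "eventually (\<lambda>s. s \<in> {0<..<\<tau>1}) (at_right 0)" using \<tau>1 by (rule eventually_at_right_real)
    ultimately have "eventually (\<lambda>s. s \<in> T) (at_right 0)" by eventually_elim (simp add: T_def)
    then show ?thesis by (rule eventually_happens'[OF trivial_limit_at_right_real])
  qed
  then have "T \<noteq> {}" by blast
  have bdd: "bdd_above T" by (auto simp: T_def)
  define \<sigma> where "\<sigma> = Sup T"
  obtain f where f: "\<And>k. f k \<in> T" "f \<longlonglongrightarrow> \<sigma>"
    using closure_contains_Sup[OF \<open>T \<noteq> {}\<close> bdd] closure_sequential[of \<sigma> T] unfolding \<sigma>_def by blast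
  have "f 0 \<le> \<sigma>" unfolding \<sigma>_def by (intro cSup_upper f bdd)
  then have "\<sigma> > 0" using f(1)[of 0] by (simp add: T_def)
  have "\<sigma> \<le> \<tau>1" by (rule LIMSEQ_le_const2[OF f(2)]) (use f(1) T_def in blast)
  have "\<exists>X. transpose X = X \<and> ric A (f k *\<^sub>R S) W X = 0 \<and> lyap_stable (A + X ** (f k *\<^sub>R S))" for k
    using f(1)[of k] ric_stabilizing_solution[OF psdS W] unfolding T_def
    by (smt (verit) mem_Collect_eq)
  then obtain X where X: "\<And>k. transpose (X k) = X k" "\<And>k. ric A (f k *\<^sub>R S) W (X k) = 0"
    "\<And>k. lyap_stable (A + X k ** (f k *\<^sub>R S))" by metis
  obtain c where c: "c > 0" "\<And>x. c * (norm x)\<^sup>2 \<le> x \<bullet> (S *v x)" using pd_bounded_below[OF S] by blast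
  \<comment> \<open>Staying above half the limit makes the norm bound uniform in
    \<open>k\<close>.\<close>
  have "eventually (\<lambda>k. f k > \<sigma> / 2) sequentially" using f(2) \<open>\<sigma> > 0\<close> by (intro order_tendstoD) auto
  then obtain N where N: "\<And>k. k \<ge> N \<Longrightarrow> f k > \<sigma> / 2" by (auto simp: eventually_sequentially)
  have bound: "norm (X (k + N)) \<le> 2 * norm A / (\<sigma> / 2 * c)" for k
  proof -
    have "\<sigma> / 2 * c * norm (X (k + N)) \<le> f (k + N) * c * norm (X (k + N))"
      using N[of "k + N"] c by (intro mult_right_mono) auto
    also have "\<dots> \<le> 2 * norm A"
      using f(1)[of "k + N"] by (intro ric_solution_bound[OF c(2) W X(1,2)]) (simp add: T_def)
    finally show ?thesis using c \<open>\<sigma> > 0\<close> by (simp add: field_simps)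
  qed
  have "\<exists>l r. strict_mono r \<and> ((\<lambda>k. X (k + N)) \<circ> r) \<longlonglongrightarrow> l"
  proof -
    have "compact (cball (0::real^'n^'n) (2 * norm A / (\<sigma> / 2 * c)))" by simp
    moreover have "X (k + N) \<in> cball 0 (2 * norm A / (\<sigma> / 2 * c))" for k using bound by simp
    ultimately show ?thesis unfolding compact_def by meson
  qed
  then obtain L r where r: "strict_mono r" "(\<lambda>k. X (r k + N)) \<longlonglongrightarrow> L" by (auto simp: o_def)
  have fr: "(\<lambda>k. f (r k + N)) \<longlonglongrightarrow> \<sigma>"
    using LIMSEQ_subseq_LIMSEQ[OF LIMSEQ_ignore_initial_segment[OF f(2), of N] r(1)] by (simp add: o_def)
  have Lsym: "transpose L = L" using LIMSEQ_unique[OF tendsto_transpose[OF r(2)]] r(2) by (simp add: X(1))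
  have "(\<lambda>k. ric A (f (r k + N) *\<^sub>R S) W (X (r k + N))) \<longlonglongrightarrow> ric A (\<sigma> *\<^sub>R S) W L"
    by (intro tendsto_ric tendsto_intros fr r(2))
  then have ricL: "ric A (\<sigma> *\<^sub>R S) W L = 0" unfolding X(2) using LIMSEQ_unique tendsto_const by blast
  have stL: "lyap_stable (A + L ** (\<sigma> *\<^sub>R S))"
  proof (rule lyap_stable_limit')
    show "(\<lambda>k. A + X (r k + N) ** (f (r k + N) *\<^sub>R S)) \<longlonglongrightarrow> A + L ** (\<sigma> *\<^sub>R S)"
      by (intro tendsto_intros tendsto_matrix_mult fr r(2))
    show "lyap_stable (A + X (r k + N) ** (f (r k + N) *\<^sub>R S))" for k by (rule X(3))
    show "\<not> eigenpair (A + L ** (\<sigma> *\<^sub>R S)) 0 \<omega> a b" for \<omega> a b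
      by (rule gap[OF \<open>\<sigma> > 0\<close> \<open>\<sigma> \<le> \<tau>1\<close> Lsym ricL])
  qed
  have psdSS: "psd (\<sigma> *\<^sub>R S)" using psdS \<open>\<sigma> > 0\<close> by simp
  have psdL: "psd L"
  proof (rule lyap_comparison[OF A Lsym])
    have "- lyap_op A L = L ** (\<sigma> *\<^sub>R S) ** L + W"
      using ricL by (intro minus_unique) (simp add: ric_def add.assoc)
    then show "psd (- lyap_op A L)" using psd_add[OF psd_sandwich[OF psdSS Lsym] W] by simp
  qed
  obtain U where U: "pd U" "pd (- ric A (\<sigma> *\<^sub>R S) W U)"
    using ric_strict_supersolution[OF psdSS psdL ricL stL Wsym] by blast
  have "\<sigma> = \<tau>1"
  proof (rule ccontr)
    assume "\<sigma> \<noteq> \<tau>1" then have "\<sigma> < \<tau>1" using \<open>\<sigma> \<le> \<tau>1\<close> by simp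
    have "eventually (\<lambda>s. \<exists>U. pd U \<and> pd (- ric A (s *\<^sub>R S) W U)) (at_right \<sigma>)"
      using U by (rule open_T) (rule tendsto_ident_at)
    moreover have "eventually (\<lambda>s. s \<in> {\<sigma><..<\<tau>1}) (at_right \<sigma>)" using \<open>\<sigma> < \<tau>1\<close> by (rule eventually_at_right_real)
    ultimately have "eventually (\<lambda>s. s \<in> T \<and> s > \<sigma>) (at_right \<sigma>)"
      by eventually_elim (use \<open>\<sigma> > 0\<close> in \<open>simp add: T_def\<close>)
    then have "\<exists>s. s \<in> T \<and> s > \<sigma>" by (rule eventually_happens'[OF trivial_limit_at_right_real])
    then obtain s where "s \<in> T" "s > \<sigma>" by blast
    then show False using cSup_upper[OF _ bdd, of s] by (simp add: \<sigma>_def)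
  qed
  then show thesis using that Lsym ricL stL by simp
qed

section \<open>The transfer function on the imaginary axis\<close>

lemma norm_Cinf:
  fixes Qi :: "real^'n^'n" and Ri :: "real^'m^'m" and K :: "real^'n^'m"
  assumes "pd Qi" "pd Ri"
  shows "(norm (Cinf Qi Ri K *v x))\<^sup>2 = x \<bullet> (S_mat Qi Ri K *v x)"
proof -
  have sq: "(norm (psd_sqrt M *v y))\<^sup>2 = y \<bullet> (M *v y)" if "pd M" for M :: "real^'a^'a" and y
    by (metis psd_sqrt_square[OF that] dot_square_norm inner_symmetric matrix_vector_mul_assoc)
  have comp: "(Cinf Qi Ri K *v x) $ Inl i = (psd_sqrt Qi *v x) $ i"
    "(Cinf Qi Ri K *v x) $ Inr j = (psd_sqrt Ri *v (K *v x)) $ j" for i j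
    by (simp_all add: Cinf_def matrix_vector_mul_assoc) (simp_all add: matrix_vector_mult_def)
  have "(norm (Cinf Qi Ri K *v x))\<^sup>2 = (\<Sum>i\<in>UNIV <+> UNIV. ((Cinf Qi Ri K *v x) $ i)\<^sup>2)"
    by (simp add: norm_vec_def L2_set_def sum_nonneg)
  also have "\<dots> = (norm (psd_sqrt Qi *v x))\<^sup>2 + (norm (psd_sqrt Ri *v (K *v x)))\<^sup>2"
    by (simp add: sum.Plus comp norm_vec_def L2_set_def sum_nonneg del: UNIV_Plus_UNIV)
  also have "\<dots> = x \<bullet> (S_mat Qi Ri K *v x)"
    by (simp add: sq assms S_mat_def vec_simps inner_transpose)
  finally show ?thesis .
qed

lemma pd_S_mat:
  assumes "pd Qi" "psd Ri" shows "pd (S_mat Qi Ri K)"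
  unfolding S_mat_def by (intro pd_add_psd assms psd_congruence)

text \<open>A Lyapunov matrix of \<open>transpose M\<close> bounds \<open>z\<close> from the real
  part of a pairing to which the imaginary shift contributes nothing, so \<open>C\<close> does not
  depend on the frequency.\<close>

lemma resolvent_bound:
  fixes M :: "real^'n^'n"
  assumes "hurwitz M"
  obtains C where "C \<ge> 0"
    "\<And>\<omega> z. norm z \<le> C * norm ((mat (\<i> * complex_of_real \<omega>) - cmat M) *v z)"
proof -
  obtain P where P: "pd P" "pd (- lyap_op (transpose M) P)"
    using hurwitz_imp_lyap_stable[OF hurwitz_transpose[OF assms]] by (auto simp: lyap_stable_def)
  obtain c where c: "c > 0" "\<And>x. c * (norm x)\<^sup>2 \<le> x \<bullet> (- lyap_op (transpose M) P *v x)"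
    using pd_bounded_below[OF P(2)] by blast
  have sym: "transpose P = P" using P(1) by (rule pd_symD)
  have "x \<bullet> (lyap_op (transpose M) P *v x) = 2 * ((M *v x) \<bullet> (P *v x))" for x
    unfolding lyap_op_quadratic_form[OF sym]
    using inner_transpose[of x M "P *v x"] by (simp add: inner_commute)
  then have lower: "c * (norm x)\<^sup>2 \<le> - 2 * ((M *v x) \<bullet> (P *v x))" for x
    using c(2)[of x] by (simp add: bounded_bilinear.minus_left[OF bounded_bilinear_matrix_vector_mult])
  show thesis
  proof
    show "4 * norm P / c \<ge> 0" using c(1) by simp
    fix \<omega> and z :: "complex^'n"
    obtain a b where z: "z = cvec a b" by (rule cvec_cases)
    define u v where "u = - \<omega> *\<^sub>R b - M *v a" and "v = \<omega> *\<^sub>R a - M *v b"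
    have w: "(mat (\<i> * complex_of_real \<omega>) - cmat M) *v z = cvec u v"
      unfolding z u_def v_def matrix_vector_mult_diff_rdistrib mat_cvec cmat_cvec
      by (auto simp: cvec_def vec_eq_iff complex_eq_iff)
    have le: "norm a' \<le> norm (cvec a' b')" "norm b' \<le> norm (cvec a' b')" for a' b' :: "real^'n"
      by (rule power2_le_imp_le; simp add: norm_cvec)+
    have term_bound: "x \<bullet> (P *v y) \<le> norm (cvec u v) * (norm P * norm z)"
      if "norm x \<le> norm (cvec u v)" "norm y \<le> norm z" for x y
    proof -
      have "x \<bullet> (P *v y) \<le> norm x * norm (P *v y)" by (rule norm_cauchy_schwarz)
      also have "\<dots> \<le> norm x * (norm P * norm y)"
        by (intro mult_left_mono norm_matrix_vector_mult_le) auto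
      also have "\<dots> \<le> norm (cvec u v) * (norm P * norm z)"
        using that by (intro mult_mono) auto
      finally show ?thesis .
    qed
    have "c * (norm z)\<^sup>2 \<le> - 2 * ((M *v a) \<bullet> (P *v a)) - 2 * ((M *v b) \<bullet> (P *v b))"
      using lower[of a] lower[of b] by (simp add: z norm_cvec algebra_simps)
    \<comment> \<open>The terms with \<open>\<omega>\<close> cancel by symmetry of
      \<open>P\<close>.\<close>
    also have "\<dots> = 2 * (u \<bullet> (P *v a)) + 2 * (v \<bullet> (P *v b))"
      using inner_symmetric[OF sym, of a b] by (simp add: u_def v_def vec_simps inner_commute algebra_simps)
    also have "\<dots> \<le> 4 * (norm (cvec u v) * (norm P * norm z))"
      using term_bound[of u a] term_bound[of v b] le(1)[of u v] le(2)[where a' = u and b' = v]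
        le(1)[of a b] le(2)[where a' = a and b' = b] by (simp add: z)
    finally have "(c * norm z) * norm z \<le> (4 * norm P * norm (cvec u v)) * norm z"
      by (simp add: power2_eq_square mult_ac)
    then have "c * norm z \<le> 4 * norm P * norm (cvec u v)"
      by (cases "z = 0") (auto simp: mult_le_cancel_right)
    then show "norm z \<le> 4 * norm P / c * norm ((mat (\<i> * complex_of_real \<omega>) - cmat M) *v z)"
      unfolding w using c(1) by (simp add: field_simps)
  qed
qed

lemma hurwitz_resolvent_inverse:
  assumes "hurwitz M"
  shows "(mat (\<i> * complex_of_real \<omega>) - cmat M) ** matrix_inv (mat (\<i> * complex_of_real \<omega>) - cmat M) = mat 1"
    "matrix_inv (mat (\<i> * complex_of_real \<omega>) - cmat M) ** (mat (\<i> * complex_of_real \<omega>) - cmat M) = mat 1"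
proof -
  have "det (mat (\<i> * complex_of_real \<omega>) - cmat M) \<noteq> 0"
    using assms unfolding hurwitz_def by fastforce
  then have "invertible (mat (\<i> * complex_of_real \<omega>) - cmat M)" by (simp add: invertible_det_nz)
  then show "(mat (\<i> * complex_of_real \<omega>) - cmat M) ** matrix_inv (mat (\<i> * complex_of_real \<omega>) - cmat M) = mat 1"
    "matrix_inv (mat (\<i> * complex_of_real \<omega>) - cmat M) ** (mat (\<i> * complex_of_real \<omega>) - cmat M) = mat 1"
    by (auto simp: matrix_inv_def invertible_def intro: someI2_ex)
qed

text \<open>The content is boundedness over all frequencies: a real \<open>SUP\<close> dominates its
  members only for a family bounded above.\<close>

lemma spec_norm_le_hinf_norm:
  assumes "hurwitz (closed_loop A B K)"
  shows "spec_norm (Tinf A B Bw Qi Ri K (\<i> * complex_of_real \<omega>)) \<le> hinf_norm A B Bw Qi Ri K"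
proof -
  let ?M = "closed_loop A B K"
  let ?\<Phi> = "\<lambda>\<omega>. mat (\<i> * complex_of_real \<omega>) - cmat ?M"
  let ?C = "cmat (Cinf Qi Ri K)"
  obtain C where C: "C \<ge> 0" "\<And>\<omega> z. norm z \<le> C * norm (?\<Phi> \<omega> *v z)"
    using resolvent_bound[OF assms] by blast
  have "spec_norm (Tinf A B Bw Qi Ri K (\<i> * complex_of_real \<omega>)) \<le> norm ?C * (C * norm (cmat Bw))" for \<omega>
    unfolding spec_norm_def
  proof (rule onorm_le)
    fix x
    let ?y = "cmat Bw *v x" let ?z = "matrix_inv (?\<Phi> \<omega>) *v ?y"
    have "norm (Tinf A B Bw Qi Ri K (\<i> * complex_of_real \<omega>) *v x) = norm (?C *v ?z)"
      by (simp add: Tinf_def matrix_vector_mul_assoc matrix_mul_assoc)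
    also have "\<dots> \<le> norm ?C * norm ?z" by (rule norm_matrix_vector_mult_le)
    also have "norm ?z \<le> C * norm (?\<Phi> \<omega> *v ?z)" by (rule C)
    also have "?\<Phi> \<omega> *v ?z = ?y"
      by (simp add: matrix_vector_mul_assoc matrix_mul_assoc hurwitz_resolvent_inverse[OF assms])
    also have "norm ?y \<le> norm (cmat Bw) * norm x" by (rule norm_matrix_vector_mult_le)
    finally show "norm (Tinf A B Bw Qi Ri K (\<i> * complex_of_real \<omega>) *v x) \<le> norm ?C * (C * norm (cmat Bw)) * norm x"
      using C(1) by (simp add: mult_left_mono mult.assoc)
  qed
  then have "bdd_above (range (\<lambda>\<omega>. spec_norm (Tinf A B Bw Qi Ri K (\<i> * complex_of_real \<omega>))))"
    by (auto simp: bdd_above_def)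
  then show ?thesis unfolding hinf_norm_def by (rule cSUP_upper2) auto
qed

text \<open>If \<open>M\<^sup>T v = -\<i>\<nu> v\<close> for \<open>M = A + \<tau> X S\<close>, then \<open>(\<i>\<nu> - A)\<^sup>-\<^sup>1 W v = X v\<close>. Hence the transfer function
  maps \<open>Bw\<^sup>T v\<close> to \<open>C X v\<close>, and \<open>\<parallel>Bw\<^sup>T v\<parallel>\<^sup>2 = \<tau> \<parallel>C X v\<parallel>\<^sup>2\<close>.\<close>

lemma hinf_norm_no_imaginary_eigenvalue:
  fixes A Bw Qi :: "real^'n^'n" and B :: "real^'m^'n" and Ri :: "real^'m^'m" and K :: "real^'n^'m"
  assumes hurw: "hurwitz (closed_loop A B K)" and hinf: "hinf_norm A B Bw Qi Ri K < \<beta>" and "\<beta> > 0"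
    and pd: "pd Qi" "pd Ri" "pd (Bw ** transpose Bw)"
    and \<tau>: "0 < \<tau>" "\<tau> \<le> 1 / \<beta>\<^sup>2" and X: "transpose X = X"
    and ric0: "ric (closed_loop A B K) (\<tau> *\<^sub>R S_mat Qi Ri K) (Bw ** transpose Bw) X = 0"
  shows "\<not> eigenpair (closed_loop A B K + X ** (\<tau> *\<^sub>R S_mat Qi Ri K)) 0 \<omega> a b"
proof
  define M where "M = closed_loop A B K"
  define S where "S = S_mat Qi Ri K"
  define W where "W = Bw ** transpose Bw"
  assume "eigenpair (closed_loop A B K + X ** (\<tau> *\<^sub>R S_mat Qi Ri K)) 0 \<omega> a b"
  then obtain a b where eig: "eigenpair (transpose (M + X ** (\<tau> *\<^sub>R S))) 0 \<omega> a b"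
    unfolding M_def S_def by (rule eigenpair_transpose)
  define \<nu> where "\<nu> = - \<omega>"
  have Ssym: "transpose S = S" unfolding S_def by (intro pd_symD pd_S_mat pd pd_imp_psd)
  have MT: "transpose M *v v + \<tau> *\<^sub>R (S *v (X *v v)) = transpose (M + X ** (\<tau> *\<^sub>R S)) *v v" for v
    by (simp add: mat_simps Ssym X vec_simps)
  have Wv: "W *v v = - (M *v (X *v v)) - X *v (transpose M *v v + \<tau> *\<^sub>R (S *v (X *v v)))" for v
  proof -
    have "0 = (ric M (\<tau> *\<^sub>R S) W X) *v v" using ric0 by (simp add: M_def S_def W_def)
    also have "\<dots> = M *v (X *v v) + X *v (transpose M *v v + \<tau> *\<^sub>R (S *v (X *v v))) + W *v v"
      by (simp add: ric_def lyap_op_def mat_simps vec_simps)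
    finally show ?thesis by (simp add: eq_neg_iff_add_eq_0 algebra_simps)
  qed
  have Wa: "W *v a = - (M *v (X *v a)) - \<nu> *\<^sub>R (X *v b)" and Wb: "W *v b = - (M *v (X *v b)) + \<nu> *\<^sub>R (X *v a)"
    using eig unfolding Wv MT eigenpair_def by (simp_all add: vec_simps \<nu>_def)
  let ?\<Phi> = "mat (\<i> * complex_of_real \<nu>) - cmat M"
  let ?z = "cvec (X *v a) (X *v b)" and ?x = "cvec (transpose Bw *v a) (transpose Bw *v b)"
  have "?\<Phi> *v ?z = cvec (W *v a) (W *v b)"
    unfolding Wa Wb matrix_vector_mult_diff_rdistrib mat_cvec cmat_cvec
    by (auto simp: cvec_def vec_eq_iff complex_eq_iff)
  also have "\<dots> = cmat Bw *v ?x" by (simp add: cmat_cvec W_def vec_simps)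
  finally have "cmat Bw *v ?x = ?\<Phi> *v ?z" ..
  then have Tx: "Tinf A B Bw Qi Ri K (\<i> * complex_of_real \<nu>) *v ?x = cmat (Cinf Qi Ri K) *v ?z"
    using hurwitz_resolvent_inverse(2)[OF hurw, of \<nu>] unfolding M_def Tinf_def
    by (metis matrix_vector_mul_assoc matrix_vector_mul_lid)
  define s w where "s = (X *v a) \<bullet> (S *v (X *v a)) + (X *v b) \<bullet> (S *v (X *v b))"
    and "w = a \<bullet> (W *v a) + b \<bullet> (W *v b)"
  have norm_s: "(norm (cmat (Cinf Qi Ri K) *v ?z))\<^sup>2 = s"
    by (simp add: cmat_cvec norm_cvec norm_Cinf[OF pd(1,2)] s_def S_def)
  have norm_w: "(norm ?x)\<^sup>2 = w"
    using inner_transpose[of _ "transpose Bw"]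
    unfolding norm_cvec unfolding power2_norm_eq_inner w_def W_def by (simp add: vec_simps)
  have "w > 0"
    unfolding w_def using eig pdD[OF pd(3)] psdD[OF pd_imp_psd[OF pd(3)]]
    unfolding W_def[symmetric] eigenpair_def by (metis add_pos_nonneg add_nonneg_pos)
  \<comment> \<open>\<open>q\<close> is the real part of the pairing of \<open>v\<close> with
    \<open>M X v\<close>. The eigenvector relation gives \<open>w = - q\<close>, the Riccati
    equation \<open>w = - 2 * q - \<tau> * s\<close>; eliminating \<open>q\<close> leaves
    \<open>w = \<tau> * s\<close>.\<close>
  define q where "q = a \<bullet> (M *v (X *v a)) + b \<bullet> (M *v (X *v b))"
  have "w = - q"
    using inner_symmetric[OF X, of a b]
    by (simp add: w_def q_def Wa Wb vec_simps inner_commute algebra_simps)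
  moreover have "w = - 2 * q - \<tau> * s"
  proof -
    have "v \<bullet> (W *v v) = - 2 * (v \<bullet> (M *v (X *v v))) - \<tau> * ((X *v v) \<bullet> (S *v (X *v v)))" for v
      using inner_transpose[of "X *v v" M v]
      by (simp add: Wv vec_simps inner_symmetric[OF X, of v] inner_commute)
    from this[of a] this[of b] show ?thesis by (simp add: w_def q_def s_def algebra_simps)
  qed
  ultimately have ws: "w = \<tau> * s" by simp
  then have "s > 0" using \<open>w > 0\<close> \<tau>(1) by (simp add: zero_less_mult_iff)
  define h where "h = spec_norm (Tinf A B Bw Qi Ri K (\<i> * complex_of_real \<nu>))"
  have h: "0 \<le> h" "h < \<beta>"
    unfolding h_def using spec_norm_le_hinf_norm[OF hurw, of Bw Qi Ri \<nu>] hinf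
    by (auto simp: spec_norm_def intro: onorm_pos_le)
  have "norm (cmat (Cinf Qi Ri K) *v ?z) \<le> h * norm ?x"
    unfolding Tx[symmetric] h_def spec_norm_def by (rule onorm) simp
  then have "(norm (cmat (Cinf Qi Ri K) *v ?z))\<^sup>2 \<le> (h * norm ?x)\<^sup>2" by (rule power_mono) simp
  then have "s \<le> h\<^sup>2 * \<tau> * s" unfolding norm_s power_mult_distrib norm_w ws by simp
  then have "1 \<le> h\<^sup>2 * \<tau>" using \<open>s > 0\<close> by simp
  also have "h\<^sup>2 * \<tau> \<le> h\<^sup>2 * (1 / \<beta>\<^sup>2)" using \<tau>(2) by (rule mult_left_mono) simp
  also have "\<dots> < 1"
    using h \<open>\<beta> > 0\<close> by (simp add: power_strict_mono)
  finally show False by simp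
qed

text \<open>Definiteness of \<open>X\<close> is inherited from that of \<open>W\<close> through the
  Lyapunov equation of the closed loop. It is what later permits recovering a gain from the lifted
  variables.\<close>

lemma Kbeta_stabilizing_solution:
  fixes A Bw Qi :: "real^'n^'n" and B :: "real^'m^'n" and Ri :: "real^'m^'m" and K :: "real^'n^'m"
  assumes "K \<in> Kbeta A B Bw Qi Ri \<beta>" "\<beta> > 0" and pd: "pd Qi" "pd Ri" "pd (Bw ** transpose Bw)"
  obtains X where "pd X"
    "ric (closed_loop A B K) ((1 / \<beta>\<^sup>2) *\<^sub>R S_mat Qi Ri K) (Bw ** transpose Bw) X = 0"
    "lyap_stable (closed_loop A B K + X ** ((1 / \<beta>\<^sup>2) *\<^sub>R S_mat Qi Ri K))"
proof -
  have hurw: "hurwitz (closed_loop A B K)" and hinf: "hinf_norm A B Bw Qi Ri K < \<beta>"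
    using assms(1) by (auto simp: Kbeta_def stabilizing_set_def)
  have st: "lyap_stable (closed_loop A B K)" using hurw by (rule hurwitz_imp_lyap_stable)
  have S: "pd (S_mat Qi Ri K)" by (intro pd_S_mat pd pd_imp_psd)
  obtain X where X: "transpose X = X"
    "ric (closed_loop A B K) ((1 / \<beta>\<^sup>2) *\<^sub>R S_mat Qi Ri K) (Bw ** transpose Bw) X = 0"
    "lyap_stable (closed_loop A B K + X ** ((1 / \<beta>\<^sup>2) *\<^sub>R S_mat Qi Ri K))"
    using ric_homotopy[OF st S pd_imp_psd[OF pd(3)], of "1 / \<beta>\<^sup>2"]
      hinf_norm_no_imaginary_eigenvalue[OF hurw hinf assms(2) pd] assms(2) by (metis zero_less_divide_1_iff zero_less_power)
  have "- lyap_op (closed_loop A B K) X = X ** ((1 / \<beta>\<^sup>2) *\<^sub>R S_mat Qi Ri K) ** X + Bw ** transpose Bw"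
    using X(2) by (intro minus_unique) (simp add: ric_def add.assoc)
  moreover have "pd (X ** ((1 / \<beta>\<^sup>2) *\<^sub>R S_mat Qi Ri K) ** X + Bw ** transpose Bw)"
    by (intro psd_add_pd psd_sandwich psd_scaleR pd_imp_psd[OF S] X pd) simp
  ultimately have "pd (- lyap_op (closed_loop A B K) X)" by simp
  then have "pd X" using lyap_stable_pd[OF st X(1)] by blast
  then show thesis using that X by blast
qed

text \<open>Stated for any gain with a stabilizing solution rather than for members of
  \<open>Kbeta\<close>, since the gains on the descent curve are known only through such a
  solution.\<close>

lemma riccati_X_eq:
  fixes A Bw Qi :: "real^'n^'n" and B :: "real^'m^'n" and Ri :: "real^'m^'m" and K :: "real^'n^'m"
  assumes "psd (S_mat Qi Ri K)" and X: "transpose X = X"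
    "ric (closed_loop A B K) ((1 / \<beta>\<^sup>2) *\<^sub>R S_mat Qi Ri K) (Bw ** transpose Bw) X = 0"
    "lyap_stable (closed_loop A B K + X ** ((1 / \<beta>\<^sup>2) *\<^sub>R S_mat Qi Ri K))"
  shows "riccati_X A B Bw Qi Ri \<beta> K = X"
proof -
  have psd: "psd ((1 / \<beta>\<^sup>2) *\<^sub>R S_mat Qi Ri K)" using assms(1) by (simp add: psd_scaleR)
  have ric: "closed_loop A B K ** Y + Y ** transpose (closed_loop A B K)
         + (1 / \<beta>\<^sup>2) *\<^sub>R (Y ** S_mat Qi Ri K ** Y) + Bw ** transpose Bw
      = ric (closed_loop A B K) ((1 / \<beta>\<^sup>2) *\<^sub>R S_mat Qi Ri K) (Bw ** transpose Bw) Y" for Y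
    by (simp add: ric_def lyap_op_def mat_simps)
  have stab: "hurwitz (closed_loop A B K + (1 / \<beta>\<^sup>2) *\<^sub>R (Y ** S_mat Qi Ri K))
      \<longleftrightarrow> lyap_stable (closed_loop A B K + Y ** ((1 / \<beta>\<^sup>2) *\<^sub>R S_mat Qi Ri K))" for Y
    by (simp add: hurwitz_iff_lyap_stable bounded_bilinear.scaleR_right[OF bounded_bilinear_matrix_mult])
  show ?thesis
    unfolding riccati_X_def ric stab
    by (rule the_equality) (use X ric_stabilizing_unique[OF psd] in blast)+
qed

section \<open>Convexity in the lifted variables\<close>

lemma matrix_square_convex_combination:
  fixes X X' :: "real^'n^'m"
  defines "Xt \<equiv> \<lambda>t. (1 - t) *\<^sub>R X + t *\<^sub>R X'"
  shows "transpose (Xt t) ** Q ** Xt t = (1 - t) *\<^sub>R (transpose X ** Q ** X)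
      + t *\<^sub>R (transpose X' ** Q ** X') - (t * (1 - t)) *\<^sub>R (transpose (X - X') ** Q ** (X - X'))"
proof -
  have gen: "(1 - t) *\<^sub>R ((1 - t) *\<^sub>R a + t *\<^sub>R c) + t *\<^sub>R ((1 - t) *\<^sub>R b + t *\<^sub>R d)
      = (1 - t) *\<^sub>R a + t *\<^sub>R d - (t * (1 - t)) *\<^sub>R ((a - c) - (b - d))" for a b c d :: "real^'n^'n"
    by (simp add: vec_eq_iff) (simp add: algebra_simps power2_eq_square)
  show ?thesis
    using gen[of "transpose X ** Q ** X" "transpose X' ** Q ** X'"
        "transpose X ** Q ** X'" "transpose X' ** Q ** X"]
    unfolding Xt_def by (simp add: mat_simps algebra_simps)
qed

text \<open>With \<open>Y = K X\<close> the product \<open>B K X\<close> becomes the linear term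
  \<open>B Y\<close>, and the part of the quadratic term that contains the gain becomes a square in
  \<open>Y\<close> alone.\<close>

definition lifted_ric :: "real^'n^'n \<Rightarrow> real^'m^'n \<Rightarrow> real^'n^'n \<Rightarrow> real^'m^'m \<Rightarrow> real \<Rightarrow> real^'n^'n
    \<Rightarrow> real^'n^'n \<Rightarrow> real^'n^'m \<Rightarrow> real^'n^'n" where
  "lifted_ric A B Qi Ri \<tau> W X Y = A ** X + transpose (A ** X) + (B ** Y + transpose (B ** Y))
     + \<tau> *\<^sub>R (transpose X ** Qi ** X + transpose Y ** Ri ** Y) + W"

lemma ric_eq_lifted_ric:
  assumes "transpose X = X"
  shows "ric (closed_loop A B K) (\<tau> *\<^sub>R S_mat Qi Ri K) W X = lifted_ric A B Qi Ri \<tau> W X (K ** X)"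
  by (simp add: ric_def lyap_op_def closed_loop_def S_mat_def lifted_ric_def mat_simps assms)

lemma lifted_ric_convex:
  fixes A Qi X X' :: "real^'n^'n" and Y Y' :: "real^'n^'m"
  assumes "lifted_ric A B Qi Ri \<tau> W X Y = 0" "lifted_ric A B Qi Ri \<tau> W X' Y' = 0"
    and "psd Qi" "psd Ri" "\<tau> \<ge> 0" "0 \<le> t" "t \<le> 1"
  shows "psd (- lifted_ric A B Qi Ri \<tau> W ((1 - t) *\<^sub>R X + t *\<^sub>R X') ((1 - t) *\<^sub>R Y + t *\<^sub>R Y'))"
proof -
  define Xt Yt where "Xt = (1 - t) *\<^sub>R X + t *\<^sub>R X'" and "Yt = (1 - t) *\<^sub>R Y + t *\<^sub>R Y'"
  define lin where "lin X Y = A ** X + transpose (A ** X) + (B ** Y + transpose (B ** Y))"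
    for X :: "real^'n^'n" and Y :: "real^'n^'m"
  have lin: "lin Xt Yt = (1 - t) *\<^sub>R lin X Y + t *\<^sub>R lin X' Y'"
    by (simp add: lin_def Xt_def Yt_def mat_simps algebra_simps)
  define sq where "sq X Y = transpose X ** Qi ** X + transpose Y ** Ri ** Y"
    for X :: "real^'n^'n" and Y :: "real^'n^'m"
  define D where "D = sq (X - X') (Y - Y')"
  have sq: "sq Xt Yt = (1 - t) *\<^sub>R sq X Y + t *\<^sub>R sq X' Y' - (t * (1 - t)) *\<^sub>R D"
    unfolding sq_def D_def Xt_def Yt_def matrix_square_convex_combination
    by (simp add: scaleR_add_right algebra_simps)
  have L: "lifted_ric A B Qi Ri \<tau> W X Y = lin X Y + \<tau> *\<^sub>R sq X Y + W" for X Y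
    by (simp add: lifted_ric_def lin_def sq_def)
  have "lifted_ric A B Qi Ri \<tau> W Xt Yt = (1 - t) *\<^sub>R lifted_ric A B Qi Ri \<tau> W X Y
      + t *\<^sub>R lifted_ric A B Qi Ri \<tau> W X' Y' - (\<tau> * (t * (1 - t))) *\<^sub>R D"
    unfolding L lin sq by (simp add: vec_eq_iff algebra_simps)
  then have "- lifted_ric A B Qi Ri \<tau> W Xt Yt = (\<tau> * (t * (1 - t))) *\<^sub>R D" using assms(1,2) by simp
  moreover have "psd D" unfolding D_def sq_def by (intro psd_add psd_congruence assms)
  ultimately show ?thesis using assms(5-7) by (simp add: Xt_def Yt_def psd_scaleR)
qed

lemma trace_transpose: "trace (transpose M) = trace M"
  by (simp add: trace_def transpose_def)

text \<open>Joint convexity of the trace of \<open>R Y X^-1 Y^T\<close>, proved without inverses.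
  \<open>Kt\<close> is the mean of \<open>K\<close> and \<open>K'\<close> with matrix weights
  \<open>(1 - t) X\<close> and \<open>t X'\<close>, and the weighted variance around this mean is
  nonnegative.\<close>

lemma cost_convex:
  fixes X X' Q :: "real^'n^'n" and K K' Kt :: "real^'n^'m" and R :: "real^'m^'m"
  assumes R: "psd R" and X: "psd X" "psd X'" and t: "0 \<le> t" "t \<le> 1"
    and Xt: "Xt = (1 - t) *\<^sub>R X + t *\<^sub>R X'"
    and Kt: "Kt ** Xt = (1 - t) *\<^sub>R (K ** X) + t *\<^sub>R (K' ** X')"
  shows "trace ((Q + transpose Kt ** R ** Kt) ** Xt) \<le>
    (1 - t) * trace ((Q + transpose K ** R ** K) ** X) + t * trace ((Q + transpose K' ** R ** K') ** X')"
proof -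
  define c where "c K1 K2 X = trace (transpose K1 ** R ** K2 ** X)" for K1 K2 :: "real^'n^'m" and X
  have sym: "transpose X = X" "transpose X' = X'" "transpose R = R" using X R by (auto simp: psd_symD)
  have comm: "c K1 K2 X = c K2 K1 X" if "transpose X = X" for K1 K2 X
  proof -
    have "c K1 K2 X = trace (transpose (transpose K1 ** R ** K2 ** X))" by (simp add: c_def trace_transpose)
    also have "transpose (transpose K1 ** R ** K2 ** X) = X ** (transpose K2 ** R ** K1)"
      by (simp add: mat_simps that sym)
    also have "trace \<dots> = c K2 K1 X" unfolding c_def by (rule trace_mul_sym)
    finally show ?thesis .
  qed
  have expand: "c (K1 - K2) (K1 - K2) X = c K1 K1 X - 2 * c K2 K1 X + c K2 K2 X"
    if "transpose X = X" for K1 K2 X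
    using comm[OF that, of K1 K2] by (simp add: c_def mat_simps trace_sub)
  have nonneg: "0 \<le> c E E X" if "psd X" for E X
    unfolding c_def by (intro trace_mult_psd psd_congruence R that)
  have "(1 - t) * c Kt K X + t * c Kt K' X' = trace (transpose Kt ** R ** ((1 - t) *\<^sub>R (K ** X) + t *\<^sub>R (K' ** X')))"
    by (simp add: c_def mat_simps trace_add trace_sub trace_scaleR algebra_simps)
  also have "\<dots> = c Kt Kt Xt" unfolding Kt[symmetric] c_def by (simp add: matrix_mul_assoc)
  finally have 1: "(1 - t) * c Kt K X + t * c Kt K' X' = c Kt Kt Xt" .
  have 2: "(1 - t) * c Kt Kt X + t * c Kt Kt X' = c Kt Kt Xt"
    unfolding Xt c_def by (simp add: mat_simps trace_add trace_sub trace_scaleR algebra_simps)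
  have "0 \<le> (1 - t) * c (K - Kt) (K - Kt) X + t * c (K' - Kt) (K' - Kt) X'"
    using t nonneg X by simp
  also have "\<dots> = (1 - t) * c K K X + t * c K' K' X' - c Kt Kt Xt"
    unfolding expand[OF sym(1)] expand[OF sym(2)] using 1 2 by (simp add: algebra_simps)
  finally have "c Kt Kt Xt \<le> (1 - t) * c K K X + t * c K' K' X'" by simp
  moreover have "trace ((Q + transpose K ** R ** K) ** X) = trace (Q ** X) + c K K X" for K X
    by (simp add: c_def mat_simps trace_add)
  moreover have "trace (Q ** Xt) = (1 - t) * trace (Q ** X) + t * trace (Q ** X')"
    unfolding Xt by (simp add: mat_simps trace_add trace_sub trace_scaleR algebra_simps)
  ultimately show ?thesis by (simp add: algebra_simps)
qed

text \<open>Cauchy-Schwarz applied to each row of \<open>E\<close>. It turns an O(t) bound on the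
  product of \<open>Kt - K\<close> with \<open>Xt\<close> into one on \<open>Kt - K\<close>.\<close>

lemma norm_right_factor_le:
  fixes E :: "real^'n^'m" and X :: "real^'n^'n"
  assumes X: "transpose X = X" "\<And>x. c * (norm x)\<^sup>2 \<le> x \<bullet> (X *v x)" and "c \<ge> 0"
  shows "c * norm E \<le> norm (E ** X)"
proof -
  have row: "(E ** X) $ i = X *v (E $ i)" for i
    using symmetric_entry[OF X(1)]
    by (simp add: vec_eq_iff matrix_matrix_mult_def matrix_vector_mult_def mult.commute)
  have "c * norm (E $ i) \<le> norm ((E ** X) $ i)" for i
  proof -
    have "(c * norm (E $ i)) * norm (E $ i) \<le> (E $ i) \<bullet> (X *v (E $ i))"
      using X(2)[of "E $ i"] by (simp add: power2_eq_square mult.assoc)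
    also have "\<dots> \<le> norm (E $ i) * norm (X *v (E $ i))" by (rule norm_cauchy_schwarz)
    finally show ?thesis unfolding row
      by (cases "E $ i = 0") (auto simp: mult.commute[of "norm (E $ i)"] mult_le_cancel_right)
  qed
  then have "L2_set (\<lambda>i. c * norm (E $ i)) UNIV \<le> L2_set (\<lambda>i. norm ((E ** X) $ i)) UNIV"
    using \<open>c \<ge> 0\<close> by (intro L2_set_mono) auto
  then show ?thesis using \<open>c \<ge> 0\<close> by (simp add: norm_vec_def L2_set_right_distrib)
qed

text \<open>The curve \<open>Kt\<close> through \<open>K\<close> is the segment from \<open>(X, K X)\<close> to \<open>(X', K' X')\<close>, read in the
  original coordinate \<open>K = Y X\<^sup>-\<^sup>1\<close>.\<close>

lemma J_mix_descent_curve: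
  fixes A Bw Q2 Qi :: "real^'n^'n" and B :: "real^'m^'n" and R2 Ri :: "real^'m^'m"
    and K K' :: "real^'n^'m"
  assumes "\<beta> > 0" and Q2: "psd Q2" and W: "pd (Bw ** transpose Bw)"
    and Qi: "pd Qi" and R2: "pd R2" and Ri: "pd Ri"
    and K: "K \<in> Kbeta A B Bw Qi Ri \<beta>" and K': "K' \<in> Kbeta A B Bw Qi Ri \<beta>"
  obtains Kt C where "C > 0" "(Kt \<longlongrightarrow> K) (at_right 0)"
    "eventually (\<lambda>t. norm (Kt t - K) \<le> C * t) (at_right 0)"
    "eventually (\<lambda>t. J_mix A B Bw Q2 R2 Qi Ri \<beta> (Kt t) \<le>
      (1 - t) * J_mix A B Bw Q2 R2 Qi Ri \<beta> K + t * J_mix A B Bw Q2 R2 Qi Ri \<beta> K') (at_right 0)"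
proof -
  define \<tau> where "\<tau> = 1 / \<beta>\<^sup>2"
  have \<tau>: "\<tau> \<ge> 0" by (simp add: \<tau>_def)
  define V where "V = Bw ** transpose Bw"
  have Vsym: "transpose V = V" and psdV: "psd V" using W by (auto simp: V_def pd_symD pd_imp_psd)
  define S where "S K = \<tau> *\<^sub>R S_mat Qi Ri K" for K
  have psdS: "psd (S_mat Qi Ri K)" "psd (S K)" for K
    unfolding S_def using pd_S_mat[OF Qi pd_imp_psd[OF Ri]] \<tau> by (auto intro: psd_scaleR pd_imp_psd)
  define J where "J = J_mix A B Bw Q2 R2 Qi Ri \<beta>"
  define P where "P K = Q2 + transpose K ** R2 ** K" for K
  have psdP: "psd (P K)" for K unfolding P_def by (intro psd_add psd_congruence Q2 pd_imp_psd[OF R2])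
  have J: "J L = trace (P L ** X)"
    if "transpose X = X" "ric (closed_loop A B L) (S L) V X = 0"
      "lyap_stable (closed_loop A B L + X ** S L)" for L X
    using riccati_X_eq[OF psdS(1) that(1), of A B L \<beta> Bw] that(2,3)
    by (simp add: J_def J_mix_def P_def V_def S_def \<tau>_def)
  obtain X where X: "pd X" "ric (closed_loop A B K) (S K) V X = 0"
    "lyap_stable (closed_loop A B K + X ** S K)"
    using Kbeta_stabilizing_solution[OF K assms(1) Qi Ri W] unfolding V_def S_def \<tau>_def by blast
  obtain X' where X': "pd X'" "ric (closed_loop A B K') (S K') V X' = 0"
    "lyap_stable (closed_loop A B K' + X' ** S K')"
    using Kbeta_stabilizing_solution[OF K' assms(1) Qi Ri W] unfolding V_def S_def \<tau>_def by blast
  have sym: "transpose X = X" "transpose X' = X'" using X X' by (auto simp: pd_symD)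
  define Xt where "Xt t = (1 - t) *\<^sub>R X + t *\<^sub>R X'" for t
  define Kt where "Kt t = ((1 - t) *\<^sub>R (K ** X) + t *\<^sub>R (K' ** X')) ** matrix_inv (Xt t)" for t
  have Xt_sym: "transpose (Xt t) = Xt t" for t by (simp add: Xt_def mat_simps sym)
  obtain c where c: "c > 0" "\<And>x. c * (norm x)\<^sup>2 \<le> x \<bullet> (X *v x)" using pd_bounded_below[OF X(1)] by blast
  have lower: "c / 2 * (norm x)\<^sup>2 \<le> x \<bullet> (Xt t *v x)" if "0 < t" "t < 1/2" for t x
  proof -
    have "c / 2 * (norm x)\<^sup>2 \<le> (1 - t) * (c * (norm x)\<^sup>2)"
      using c(1) that mult_right_mono[of "1/2" "1 - t" "c * (norm x)\<^sup>2"] by simp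
    also have "\<dots> \<le> (1 - t) * (x \<bullet> (X *v x))" using c(2) that by (intro mult_left_mono) auto
    also have "\<dots> \<le> x \<bullet> (Xt t *v x)"
      using psdD[OF pd_imp_psd[OF X'(1)], of x] that
      by (simp only: Xt_def vec_simps inner_scaleR_right) simp
    finally show ?thesis .
  qed
  have KtXt: "Kt t ** Xt t = (1 - t) *\<^sub>R (K ** X) + t *\<^sub>R (K' ** X')" if "0 < t" "t < 1/2" for t
  proof -
    have "Xt t *v x \<noteq> 0" if "x \<noteq> 0" for x
      using lower[OF \<open>0 < t\<close> \<open>t < 1/2\<close>, of x] c(1) that by (auto simp: mult_le_0_iff)
    then have "invertible (Xt t)"
      unfolding invertible_left_inverse matrix_left_invertible_ker by blast
    then have "matrix_inv (Xt t) ** Xt t = mat 1"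
      by (auto simp: matrix_inv_def invertible_def intro: someI2_ex)
    then show ?thesis by (simp add: Kt_def matrix_mul_assoc[symmetric])
  qed
  define G where "G = (K' - K) ** X'"
  \<comment> \<open>\<open>(Kt t - K) ** Xt t\<close> equals \<open>t *\<^sub>R G\<close>, and
    \<open>Xt t\<close> is bounded below by \<open>c / 2\<close> for \<open>t < 1/2\<close>. The 1
    keeps \<open>C\<close> positive when \<open>G = 0\<close>.\<close>
  define C where "C = 2 * norm G / c + 1"
  have small: "eventually (\<lambda>t::real. 0 < t \<and> t < 1/2) (at_right 0)"
    using eventually_at_right_real[of 0 "1/2"] by (auto elim: eventually_mono)
  have bound: "eventually (\<lambda>t. norm (Kt t - K) \<le> C * t) (at_right 0)"
    using small
  proof eventually_elim
    case (elim t)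
    have "(Kt t - K) ** Xt t = t *\<^sub>R G"
    proof -
      have "(Kt t - K) ** Xt t = (1 - t) *\<^sub>R (K ** X) + t *\<^sub>R (K' ** X') - K ** Xt t"
        using KtXt elim by (simp add: bounded_bilinear.diff_left[OF bounded_bilinear_matrix_mult])
      also have "\<dots> = t *\<^sub>R G" by (simp add: Xt_def G_def mat_simps)
      finally show ?thesis .
    qed
    then have "c / 2 * norm (Kt t - K) \<le> t * norm G"
      using norm_right_factor_le[OF Xt_sym lower, of t "Kt t - K"] elim c(1) by simp
    then have "norm (Kt t - K) \<le> 2 * norm G / c * t" using c(1) by (simp add: field_simps)
    also have "\<dots> \<le> C * t" using elim by (simp add: C_def algebra_simps)
    finally show ?case .
  qed
  have "C > 0" using c(1) by (simp add: C_def add_nonneg_pos)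
  have lim: "(Kt \<longlongrightarrow> K) (at_right 0)"
  proof (rule LIM_zero_cancel, rule Lim_null_comparison[OF bound])
    have "((\<lambda>t. C * t) \<longlongrightarrow> C * 0) (at_right (0::real))" by (intro tendsto_intros)
    then show "((\<lambda>t. C * t) \<longlongrightarrow> 0) (at_right 0)" by simp
  qed
  \<comment> \<open>One strict supersolution at \<open>K\<close> stays strict for all
    \<open>Kt t\<close> with small \<open>t\<close>, which guarantees a stabilizing solution at
    these gains and gives meaning to their cost.\<close>
  obtain U where U: "pd U" "pd (- ric (closed_loop A B K) (S K) V U)"
    using ric_strict_supersolution[OF psdS(2) pd_imp_psd[OF X(1)] X(2,3) Vsym] by blast
  have "eventually (\<lambda>t. pd (- ric (closed_loop A B (Kt t)) (S (Kt t)) V U)) (at_right 0)"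
  proof (rule eventually_pd[OF _ U(2)])
    show "((\<lambda>t. - ric (closed_loop A B (Kt t)) (S (Kt t)) V U) \<longlongrightarrow> - ric (closed_loop A B K) (S K) V U) (at_right 0)"
      unfolding closed_loop_def S_def S_mat_def
      by (intro tendsto_minus tendsto_ric tendsto_add tendsto_scaleR tendsto_matrix_mult
          tendsto_transpose tendsto_const lim)
    show "eventually (\<lambda>t. transpose (- ric (closed_loop A B (Kt t)) (S (Kt t)) V U) = - ric (closed_loop A B (Kt t)) (S (Kt t)) V U) (at_right 0)"
      by (simp add: linear_neg[OF linear_transpose] transpose_ric Vsym pd_symD[OF U(1)] psd_symD[OF psdS(2)])
  qed
  then have "eventually (\<lambda>t. J (Kt t) \<le> (1 - t) * J K + t * J K') (at_right 0)"
    using small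
  proof eventually_elim
    case (elim t)
    obtain Z where Z: "transpose Z = Z" "ric (closed_loop A B (Kt t)) (S (Kt t)) V Z = 0"
      "lyap_stable (closed_loop A B (Kt t) + Z ** S (Kt t))"
      using ric_stabilizing_solution[OF psdS(2) psdV U(1) elim(1)] by blast
    have lifted0: "lifted_ric A B Qi Ri \<tau> V X (K ** X) = 0" "lifted_ric A B Qi Ri \<tau> V X' (K' ** X') = 0"
      using X(2) X'(2) by (simp_all add: ric_eq_lifted_ric[OF sym(1), symmetric]
          ric_eq_lifted_ric[OF sym(2), symmetric] S_def)
    have "psd (- lifted_ric A B Qi Ri \<tau> V (Xt t) (Kt t ** Xt t))"
      using lifted_ric_convex[OF lifted0, of t] elim(2) \<tau> Qi Ri KtXt[of t] by (simp add: Xt_def pd_imp_psd)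
    then have "psd (- ric (closed_loop A B (Kt t)) (S (Kt t)) V (Xt t))"
      unfolding S_def ric_eq_lifted_ric[OF Xt_sym] .
    \<comment> \<open>Minimality trades the unknown solution \<open>Z\<close> for the explicit
      \<open>Xt t\<close>; the weight \<open>P (Kt t)\<close> is psd, so the trace preserves the
      order.\<close>
    then have "psd (Xt t - Z)" using ric_comparison[OF psdS(2) Z Xt_sym] by blast
    then have "trace (P (Kt t) ** Z) \<le> trace (P (Kt t) ** Xt t)"
      using trace_mult_psd[OF psdP, of "Xt t - Z" "Kt t"]
      by (simp add: bounded_bilinear.diff_right[OF bounded_bilinear_matrix_mult] trace_sub)
    also have "\<dots> \<le> (1 - t) * trace (P K ** X) + t * trace (P K' ** X')"
      unfolding P_def using elim(2) R2 X(1) X'(1) KtXt[of t]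
      by (intro cost_convex) (auto simp: Xt_def pd_imp_psd)
    finally show ?case using J[OF Z] J[OF sym(1) X(2,3)] J[OF sym(2) X'(2,3)] by simp
  qed
  then show thesis using that[OF \<open>C > 0\<close> lim bound] by (simp add: J_def)
qed

theorem theorem3:
  fixes A :: "real^'n^'n" and B :: "real^'m^'n" and Bw :: "real^'n^'n"
    and Q2 Qi :: "real^'n^'n" and R2 Ri :: "real^'m^'m"
    and \<beta> :: real and K :: "real^'n^'m"
  assumes beta_pos: "\<beta> > 0"
    and stab: "stabilizable A B"
    and detect: "detectable (psd_sqrt Q2) A"
    and beta_gt: "\<beta> > (INF K'\<in>stabilizing_set A B. hinf_norm A B Bw Qi Ri K')"
    and Q2_psd: "psd Q2"
    and W_pd: "pd (Bw ** transpose Bw)"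
    and Qi_pd: "pd Qi" and R2_pd: "pd R2" and Ri_pd: "pd Ri"
    and K_in: "K \<in> Kbeta A B Bw Qi Ri \<beta>"
    and stationary: "(J_mix A B Bw Q2 R2 Qi Ri \<beta> has_derivative (\<lambda>_. 0)) (at K)"
  shows "(\<forall>K'\<in>Kbeta A B Bw Qi Ri \<beta>. J_mix A B Bw Q2 R2 Qi Ri \<beta> K \<le> J_mix A B Bw Q2 R2 Qi Ri \<beta> K')
         \<and> J_mix A B Bw Q2 R2 Qi Ri \<beta> K = (INF K'\<in>Kbeta A B Bw Qi Ri \<beta>. J_mix A B Bw Q2 R2 Qi Ri \<beta> K')"
proof -
  let ?J = "J_mix A B Bw Q2 R2 Qi Ri \<beta>"
  have min: "?J K \<le> ?J K'" if K': "K' \<in> Kbeta A B Bw Qi Ri \<beta>" for K'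
  proof (rule ccontr)
    assume "\<not> ?J K \<le> ?J K'"
    define \<delta> where "\<delta> = ?J K - ?J K'"
    have "\<delta> > 0" using \<open>\<not> ?J K \<le> ?J K'\<close> by (simp add: \<delta>_def)
    obtain Kt C where C: "C > 0" and lim: "(Kt \<longlongrightarrow> K) (at_right 0)"
      and bound: "eventually (\<lambda>t. norm (Kt t - K) \<le> C * t) (at_right 0)"
      and descent: "eventually (\<lambda>t. ?J (Kt t) \<le> (1 - t) * ?J K + t * ?J K') (at_right 0)"
      using J_mix_descent_curve[OF beta_pos Q2_psd W_pd Qi_pd R2_pd Ri_pd K_in K'] by blast
    \<comment> \<open>With this slope the change of the cost allowed by stationarity is at most
      \<open>e * (C * t)\<close>, half of the decrease \<open>t * \<delta>\<close> that the curve
      guarantees.\<close>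
    define e where "e = \<delta> / (2 * C)"
    have "e > 0" using \<open>\<delta> > 0\<close> C by (simp add: e_def)
    then obtain d where d: "d > 0" "\<And>L. norm (L - K) < d \<Longrightarrow> norm (?J L - ?J K) \<le> e * norm (L - K)"
      using stationary unfolding has_derivative_at_alt by auto
    have "eventually (\<lambda>t. dist (Kt t) K < d) (at_right 0)" using lim d(1) by (rule tendstoD)
    then have "eventually (\<lambda>t::real. False) (at_right 0)"
      using bound descent eventually_at_right_less[of 0]
    proof eventually_elim
      case (elim t)
      have "\<bar>?J (Kt t) - ?J K\<bar> \<le> e * norm (Kt t - K)" using d(2)[of "Kt t"] elim(1) by (simp add: dist_norm)
      also have "\<dots> \<le> e * (C * t)" using elim(2) \<open>e > 0\<close> by (intro mult_left_mono) auto
      also have "\<dots> = t * \<delta> / 2" using C by (simp add: e_def)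
      finally have "- (t * \<delta> / 2) \<le> ?J (Kt t) - ?J K" by linarith
      also have "\<dots> \<le> - (t * \<delta>)" using elim(3) by (simp add: \<delta>_def algebra_simps)
      finally show False using mult_pos_pos[OF elim(4) \<open>\<delta> > 0\<close>] by linarith
    qed
    then show False by (simp add: trivial_limit_at_right_real)
  qed
  moreover have "?J K = (INF K'\<in>Kbeta A B Bw Qi Ri \<beta>. ?J K')"
    by (rule cInf_eq_minimum[symmetric]) (use K_in min in auto)
  ultimately show ?thesis by blast
qed

end
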